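(* Let $r\in\mathbb{N}_+$ and let $\{X_n:n\in\mathbb{N}\}$ be a sequence of real random variables with an $r$-max-regenerative structure (with regeneration times $S_n$, cycle lengths $Y_n$ and cycle maxima $\zeta_n^{(i)}$, $\zeta_n=\zeta_n^{(1)}$, as defined in the context) such that $\mu:=\operatorname{E}Y_1<\infty$ and $$\operatorname{P}\left(\zeta_0>\max_{1\leqslant k\leqslant n}\zeta_k\right)\to 0\quad\text{as } n\to\infty .$$ Let $G(x):=\operatorname{P}(\zeta_1\leqslant x)^{1/\mu}$ and $\beta_i(x):=\operatorname{P}\left(\zeta_1^{(i+1)}\leqslant x<\zeta_1^{(i)}\,\big|\,\zeta_1>x\right)$ for $x\in\mathbb{R}$ and $i\in\{1,2,\ldots,r-1\}$, and let $G_*:=\sup\{x\in\mathbb{R}:G(x)<1\}$. Suppose that for all $i\in\{1,2,\ldots,r-1\}$ there is $\beta_i\in[0,1]$ such that $$\beta_i(x)\to\beta_i\quad\text{as } x\nearrow G_* .$$ Then, for every $q\in\{2,3,\ldots,r\}$, $$\sup_{x\in\mathbb{R}}\left|\operatorname{P}\left(M_n^{(q)}\leqslant x\right)-G(x)^n\sum_{k=0}^{q-1}\frac{\left(-\log G(x)^n\right)^k}{k!}\gamma_{q,k}\right|\to 0\quad\text{as } n\to\infty,$$ where $M_n^{(q)}$ is the $q$-th largest value among $X_1,\ldots,X_n$ and $$\gamma_{q,k}:=\sum_{(j_1,j_2,\ldots,j_{q-1})\in J_{q,k}}\frac{k!}{j_1!j_2!\cdots j_{q-1}!}\,\beta_1^{j_1}\beta_2^{j_2}\cdots\beta_{q-1}^{j_{q-1}},$$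 with $J_{q,k}:=\left\{(j_1,\ldots,j_{q-1})\in\mathbb{N}^{q-1}:\ \sum_{i=1}^{q-1}j_i=k,\ \sum_{i=1}^{q-1}i\,j_i\leqslant q-1\right\}$.
   Context: Here $\mathbb{N}=\{0,1,2,\ldots\}$ and $\mathbb{N}_+=\{1,2,\ldots\}$. Order statistics: $M_n^{(q)}$ denotes the $q$-th largest value (counted with multiplicity) of $X_1,X_2,\ldots,X_n$ if $q\leqslant n$, and $M_n^{(q)}:=-\infty$ if $q>n$. $r$-max-regenerative structure: for $r\in\mathbb{N}_+$, the sequence $\{X_n:n\in\mathbb{N}\}$ has an $r$-max-regenerative structure if there exist integer-valued random variables $0<S_0<S_1<\cdots$ (with $S_{-1}:=0$), called regeneration times, with the following properties. For $n\geqslant 0$ let $C_n:=\{X_k:S_{n-1}\leqslant k<S_n\}$ be the $n$-th cycle, of length $Y_n:=S_n-S_{n-1}$, and let $\zeta_n^{(1)}\geqslant\zeta_n^{(2)}\geqslant\cdots\geqslant\zeta_n^{(r)}$ be the first $r$ maxima (largest values, counted with multiplicity) in the cycle $C_n$, where $\zeta_n:=\zeta_n^{(1)}$ and $\zeta_n^{(q)}:=-\infty$ if $q>Y_n$. It is required that (1) the $Y_n$ are independent for $n\geqslant 0$ and identically distributed for $n\geqslant 1$; (2) the vectors $(\zeta_n,\zeta_n^{(2)},\ldots,\zeta_n^{(r)})$ are independent for $n\geqslant 0$ and identically distributed for $n\geqslant 1$. The right endpoint $G_*$ may equal $+\infty$; $x\nearrow G_*$ means that $x$ tends to $G_*$ from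 below through values $x<G_*$ (for which $\operatorname{P}(\zeta_1>x)>0$, so $\beta_i(x)$ is well defined). Conventions: if $G(x)=0$, the expression $G(x)^n(-\log G(x)^n)^k$ is read as $0$ (its limit as $G(x)\searrow 0$); $0^0=1$, so $\gamma_{q,0}=1$ and the $k=0$ term of the sum equals $1$ also when $G(x)=1$. *)

theory Defs
  imports "HOL-Probability.Probability"
begin

text \<open>The \<open>q\<close>-th largest value (\<open>q \<ge> 1\<close>), counted with multiplicity, of the finite family
  \<open>(f k)\<close>, \<open>k \<in> I\<close>; it is \<open>-\<infinity>\<close> if the family has fewer than \<open>q\<close> members.\<close>

definition kth_largest :: "nat \<Rightarrow> ('i \<Rightarrow> real) \<Rightarrow> 'i set \<Rightarrow> ereal" where
  "kth_largest q f I =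
     (if q \<le> card I
      then ereal (rev (sorted_list_of_multiset (image_mset f (mset_set I))) ! (q - 1))
      else -\<infinity>)"

definition order_max :: "(nat \<Rightarrow> 'a \<Rightarrow> real) \<Rightarrow> nat \<Rightarrow> nat \<Rightarrow> 'a \<Rightarrow> ereal" where
  "order_max X q n \<omega> = kth_largest q (\<lambda>k. X k \<omega>) {1..n}"

text \<open>The cycles are numbered from \<open>0\<close>, and cycle \<open>0\<close> starts at \<open>S\<^sub>-\<^sub>1 = 0\<close>.\<close>

definition cycle_start :: "(nat \<Rightarrow> 'a \<Rightarrow> nat) \<Rightarrow> nat \<Rightarrow> 'a \<Rightarrow> nat" where
  "cycle_start S n \<omega> = (case n of 0 \<Rightarrow> 0 | Suc m \<Rightarrow> S m \<omega>)"

definition cycle_length :: "(nat \<Rightarrow> 'a \<Rightarrow> nat) \<Rightarrow> nat \<Rightarrow> 'a \<Rightarrow> nat" where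
  "cycle_length S n \<omega> = S n \<omega> - cycle_start S n \<omega>"

definition cycle_max ::
  "(nat \<Rightarrow> 'a \<Rightarrow> real) \<Rightarrow> (nat \<Rightarrow> 'a \<Rightarrow> nat) \<Rightarrow> nat \<Rightarrow> nat \<Rightarrow> 'a \<Rightarrow> ereal" where
  "cycle_max X S q n \<omega> = kth_largest q (\<lambda>k. X k \<omega>) {cycle_start S n \<omega>..<S n \<omega>}"

definition cycle_max_vec ::
  "(nat \<Rightarrow> 'a \<Rightarrow> real) \<Rightarrow> (nat \<Rightarrow> 'a \<Rightarrow> nat) \<Rightarrow> nat \<Rightarrow> nat \<Rightarrow> 'a \<Rightarrow> nat \<Rightarrow> ereal" where
  "cycle_max_vec X S r n \<omega> = (\<lambda>q\<in>{1..r}. cycle_max X S q n \<omega>)"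

text \<open>Lengths and maxima of the cycles are separately required to be independent and (from cycle
  \<open>1\<close> on) identically distributed; nothing is assumed about their joint law.\<close>

definition max_regenerative ::
  "'a measure \<Rightarrow> nat \<Rightarrow> (nat \<Rightarrow> 'a \<Rightarrow> real) \<Rightarrow> (nat \<Rightarrow> 'a \<Rightarrow> nat) \<Rightarrow> bool" where
  "max_regenerative M r X S \<longleftrightarrow>
     (\<forall>n. S n \<in> measurable M (count_space UNIV)) \<and>
     (\<forall>\<omega>\<in>space M. 0 < S 0 \<omega> \<and> (\<forall>n. S n \<omega> < S (Suc n) \<omega>)) \<and>
     prob_space.indep_vars M (\<lambda>_. count_space UNIV) (cycle_length S) UNIV \<and>
     (\<forall>n\<ge>1. distr M (count_space UNIV) (cycle_length S n) =
             distr M (count_space UNIV) (cycle_length S 1)) \<and>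
     prob_space.indep_vars M (\<lambda>_. Pi\<^sub>M {1..r} (\<lambda>_. borel)) (cycle_max_vec X S r) UNIV \<and>
     (\<forall>n\<ge>1. distr M (Pi\<^sub>M {1..r} (\<lambda>_. borel)) (cycle_max_vec X S r n) =
             distr M (Pi\<^sub>M {1..r} (\<lambda>_. borel)) (cycle_max_vec X S r 1))"

definition mean_cycle :: "'a measure \<Rightarrow> (nat \<Rightarrow> 'a \<Rightarrow> nat) \<Rightarrow> real" where
  "mean_cycle M S = (\<integral>\<omega>. real (cycle_length S 1 \<omega>) \<partial>M)"

definition cycle_df ::
  "'a measure \<Rightarrow> (nat \<Rightarrow> 'a \<Rightarrow> real) \<Rightarrow> (nat \<Rightarrow> 'a \<Rightarrow> nat) \<Rightarrow> real \<Rightarrow> real" where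
  "cycle_df M X S x = \<P>(\<omega> in M. cycle_max X S 1 1 \<omega> \<le> ereal x) powr (1 / mean_cycle M S)"

definition right_endpoint :: "(real \<Rightarrow> real) \<Rightarrow> ereal" where
  "right_endpoint G = (SUP x\<in>{x. G x < 1}. ereal x)"

definition cluster_prob ::
  "'a measure \<Rightarrow> (nat \<Rightarrow> 'a \<Rightarrow> real) \<Rightarrow> (nat \<Rightarrow> 'a \<Rightarrow> nat) \<Rightarrow> nat \<Rightarrow> real \<Rightarrow> real" where
  "cluster_prob M X S i x =
     \<P>(\<omega> in M. cycle_max X S (i + 1) 1 \<omega> \<le> ereal x \<and> ereal x < cycle_max X S i 1 \<omega>
        \<bar> ereal x < cycle_max X S 1 1 \<omega>)"

text \<open>The filter on the reals for \<open>x\<close> tending to an extended real \<open>c\<close> from below: it is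
  \<open>at_left\<close> for finite \<open>c\<close> and \<open>at_top\<close> for \<open>c = \<infinity>\<close>.\<close>

definition real_at_left :: "ereal \<Rightarrow> real filter" where
  "real_at_left c = filtercomap ereal (at_left c)"

lemma real_at_left_ereal: "real_at_left (ereal c) = at_left c"
proof (rule filter_eq_iff[THEN iffD2], intro allI iffI)
  fix P assume "eventually P (real_at_left (ereal c))"
  then obtain Q where Q: "eventually Q (at_left (ereal c))" "\<And>x. Q (ereal x) \<Longrightarrow> P x"
    by (auto simp: real_at_left_def eventually_filtercomap)
  from Q(1) obtain b where b: "b < ereal c" "\<And>y. b < y \<Longrightarrow> y < ereal c \<Longrightarrow> Q y"
    by (subst (asm) eventually_at_left[of "-\<infinity>"]) auto
  obtain d where d: "b < ereal d" "d < c"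
    using ereal_dense2[OF b(1)] by auto
  show "eventually P (at_left c)"
    by (subst eventually_at_left[OF d(2)])
      (use b Q d in \<open>metis ereal_less_eq(3) less_ereal.simps(1) less_trans\<close>)
next
  fix P assume "eventually P (at_left c)"
  then obtain d where d: "d < c" "\<And>y. d < y \<Longrightarrow> y < c \<Longrightarrow> P y"
    by (subst (asm) eventually_at_left[of "c - 1"]) auto
  have "eventually (\<lambda>y. ereal d < y \<and> y < ereal c) (at_left (ereal c))"
    by (subst eventually_at_left[of "-\<infinity>"]) (use d in \<open>auto intro!: exI[of _ "ereal d"]\<close>)
  then show "eventually P (real_at_left (ereal c))"
    unfolding real_at_left_def eventually_filtercomap
    using d(2) by (intro exI conjI) auto
qed

lemma real_at_left_PInf: "real_at_left \<infinity> = at_top"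
proof (rule filter_eq_iff[THEN iffD2], intro allI iffI)
  fix P assume "eventually P (real_at_left \<infinity>)"
  then obtain Q where Q: "eventually Q (at_left (\<infinity>::ereal))" "\<And>x. Q (ereal x) \<Longrightarrow> P x"
    by (auto simp: real_at_left_def eventually_filtercomap)
  from Q(1) obtain b where b: "b < \<infinity>" "\<And>y. b < y \<Longrightarrow> y < \<infinity> \<Longrightarrow> Q y"
    by (subst (asm) eventually_at_left[of "-\<infinity>"]) auto
  obtain d where d: "b < ereal d"
    using ereal_dense2[OF b(1)] by auto
  show "eventually P at_top"
    unfolding eventually_at_top_dense
    by (rule exI[of _ d]) (use b Q d in \<open>metis less_ereal.simps(1,4) less_trans\<close>)
next
  fix P :: "real \<Rightarrow> bool" assume "eventually P at_top"
  then obtain d where d: "\<And>y. d < y \<Longrightarrow> P y"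
    by (auto simp: eventually_at_top_dense)
  have "eventually (\<lambda>y. ereal d < y \<and> y < \<infinity>) (at_left (\<infinity>::ereal))"
    by (subst eventually_at_left[of "-\<infinity>"]) (auto intro!: exI[of _ "ereal d"])
  then show "eventually P (real_at_left \<infinity>)"
    unfolding real_at_left_def eventually_filtercomap
    using d by (intro exI conjI) auto
qed

definition gamma_index :: "nat \<Rightarrow> nat \<Rightarrow> (nat \<Rightarrow> nat) set" where
  "gamma_index q k =
     {j \<in> {1..q-1} \<rightarrow>\<^sub>E UNIV. (\<Sum>i=1..q-1. j i) = k \<and> (\<Sum>i=1..q-1. i * j i) \<le> q - 1}"

lemma finite_gamma_index: "finite (gamma_index q k)"
proof (rule finite_subset)
  show "gamma_index q k \<subseteq> {1..q-1} \<rightarrow>\<^sub>E {..k}"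
    unfolding gamma_index_def by (auto simp: PiE_iff extensional_def intro!: member_le_sum)
  show "finite ({1..q-1} \<rightarrow>\<^sub>E {..k})"
    by (intro finite_PiE) auto
qed

definition gamma_coeff :: "(nat \<Rightarrow> real) \<Rightarrow> nat \<Rightarrow> nat \<Rightarrow> real" where
  "gamma_coeff b q k =
     (\<Sum>j\<in>gamma_index q k.
        fact k / (\<Prod>i=1..q-1. fact (j i)) * (\<Prod>i=1..q-1. b i ^ j i))"

end

theory Submission
  imports Defs "HOL-Computational_Algebra.Polynomial" "HOL-Real_Asymp.Real_Asymp"
begin

text \<open>
  The \<open>q\<close>-th largest of \<open>X 1, \<dots>, X n\<close> is at most \<open>x\<close> iff fewer than \<open>q\<close> of these variables
  exceed \<open>x\<close>, and the exceedances come in clusters, one per cycle. Let \<open>exceed\<close> be the number of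
  exceedances in a cycle, cut off at \<open>r\<close>. As \<open>q \<le> r\<close>, the cut does not change whether the total is
  below \<open>q\<close>, and it turns the count into a function of the vector of the first \<open>r\<close> cycle maxima.
  Hence the counts are independent over the cycles and, from cycle \<open>1\<close> on, identically distributed:
  with \<open>F = P(\<zeta>\<^sub>1 \<le> x)\<close> the count is \<open>0\<close> with probability \<open>F\<close> and \<open>i\<close> with probability
  \<open>(1 - F) * \<beta>\<^sub>i(x)\<close> for \<open>0 < i < r\<close>. The generating function of \<open>m\<close> such counts is the \<open>m\<close>-th power
  of a polynomial, and the binomial and multinomial theorems give the exact formula
  \<open>P(total < q) = (\<Sum>k<q. (m choose k) * F ^ (m - k) * (1 - F) ^ k * \<gamma>\<^sub>q\<^sub>,\<^sub>k(\<beta>(x)))\<close>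
  (lemma \<open>prob_partial_sum_less_eq\<close>), in which \<open>\<gamma>\<close> is formed with the weights at level \<open>x\<close>.

  It remains to make three replacements, each with an error that vanishes uniformly in \<open>x\<close>.

  \<^item> Time \<open>n\<close> is replaced by \<open>\<lfloor>n / \<mu>\<rfloor>\<close> cycles (\<open>order_max_uniform_partial_sum\<close>). By the weak law of
  large numbers the number of cycles up to time \<open>n\<close> lies with high probability between the
  deterministic bounds \<open>(1 \<plusminus> \<epsilon>) * n / \<mu>\<close>. Since counts are nonnegative, only the events at these two
  bounds have to be compared; this separates the cycle lengths from the cycle maxima, whose joint
  law is arbitrary. The comparison is uniform in \<open>x\<close> by a pigeonhole argument: if \<open>m\<close> cycles
  contain fewer than \<open>q\<close> exceedances, then one of \<open>q\<close> blocks of \<open>L = m div q\<close> cycles contains none, which has probability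
  \<open>F ^ L\<close>; and \<open>F ^ L * (1 - F) \<le> 1 / (L + 1)\<close> for every \<open>F\<close>, so that a further exceedance in one of
  relatively few additional cycles is unlikely at any level. The same argument reduces the influence
  of the initial cycle to the hypothesis that its maximum is eventually dominated.

  \<^item> The binomial terms are replaced by Poisson terms with mean \<open>- ln F * n / \<mu>\<close>
  (\<open>binom_term_tendsto_poisson_term\<close>). In the variable \<open>u = - ln F\<close> a binomial term is squeezed
  between two copies of a Poisson term with slightly rescaled argument, and \<open>y ^ k * exp (- y)\<close> is
  insensitive to rescaling of \<open>y\<close>, uniformly on the half-line.

  \<^item> The weights \<open>\<beta>\<^sub>i(x)\<close> are replaced by their limits (\<open>cluster_weights_uniform\<close>). For levels close
  to the right endpoint this is the hypothesis; below any level \<open>x\<^sub>0\<close> with \<open>F(x\<^sub>0) < 1\<close> the binomial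
  terms themselves vanish, and where \<open>F = 1\<close> only the term \<open>k = 0\<close> is left, in which no weight occurs.
\<close>

section \<open>Order statistics and the number of exceedances\<close>

lemma nth_le_iff_length_filter:
  fixes x :: "'b::linorder"
  assumes "sorted_wrt (\<ge>) ys" "i < length ys"
  shows "ys ! i \<le> x \<longleftrightarrow> length (filter (\<lambda>y. x < y) ys) \<le> i"
  using assms
proof (induction ys arbitrary: i)
  case (Cons y ys)
  show ?case
  proof (cases "x < y")
    case True
    then show ?thesis using Cons by (cases i) auto
  next
    case False
    then have "filter (\<lambda>y. x < y) ys = []"
      using Cons.prems(1) by (force simp: filter_empty_conv)
    moreover have "(y # ys) ! i \<le> x"
    proof (cases i)
      case 0
      then show ?thesis using False by simp
    next
      case (Suc l)
      then have "ys ! l \<in> set ys" using Cons.prems(2) by simp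
      then show ?thesis using Suc False Cons.prems(1) by fastforce
    qed
    ultimately show ?thesis using False by simp
  qed
qed simp

text \<open>This equivalence trades order statistics for counts, which are additive over the cycles.\<close>

lemma kth_largest_le_iff:
  assumes "finite I" "1 \<le> q"
  shows "kth_largest q f I \<le> ereal x \<longleftrightarrow> card {k\<in>I. x < f k} < q"
proof -
  let ?xs = "sorted_list_of_multiset (image_mset f (mset_set I))"
  have len: "length ?xs = card I"
    by (metis mset_sorted_list_of_multiset size_image_mset size_mset size_mset_set)
  have "length (filter (\<lambda>y. x < y) (rev ?xs)) = size (filter_mset (\<lambda>y. x < y) (mset ?xs))"
    by (metis length_rev mset_filter rev_filter size_mset)
  also have "\<dots> = card {k\<in>I. x < f k}"
    using assms(1) by (simp add: filter_mset_image_mset)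
  finally have cnt: "length (filter (\<lambda>y. x < y) (rev ?xs)) = card {k\<in>I. x < f k}" .
  show ?thesis
  proof (cases "q \<le> card I")
    case True
    then show ?thesis
      using nth_le_iff_length_filter[of "rev ?xs" "q - 1" x] assms(2) cnt len
      by (auto simp: kth_largest_def sorted_wrt_rev)
  next
    case False
    then show ?thesis
      using card_mono[of I "{k\<in>I. x < f k}"] assms by (auto simp: kth_largest_def)
  qed
qed

section \<open>The multinomial theorem and the coefficients of the limit\<close>

definition multi_index :: "'i set \<Rightarrow> nat \<Rightarrow> ('i \<Rightarrow> nat) set" where
  "multi_index A k = {j \<in> A \<rightarrow>\<^sub>E UNIV. sum j A = k}"

lemma finite_multi_index: "finite A \<Longrightarrow> finite (multi_index A k)"
proof (rule finite_subset)
  assume "finite A"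
  then show "multi_index A k \<subseteq> A \<rightarrow>\<^sub>E {..k}"
    unfolding multi_index_def by (auto simp: PiE_iff extensional_def intro!: member_le_sum)
  show "finite (A \<rightarrow>\<^sub>E {..k})" if "finite A"
    using that by (intro finite_PiE) auto
qed

lemma bij_betw_multi_index_insert:
  assumes "finite A" "a \<notin> A"
  shows "bij_betw (\<lambda>(l, j). j(a := l)) (SIGMA l:{..k}. multi_index A (k - l))
           (multi_index (insert a A) k)"
proof (rule bij_betw_byWitness[where f' = "\<lambda>j. (j a, restrict j A)"])
  have upd: "sum (j(a := l)) A = sum j A" for j :: "_ \<Rightarrow> nat" and l
    using assms by (intro sum.cong) auto
  show "\<forall>z\<in>SIGMA l:{..k}. multi_index A (k - l).
          (\<lambda>j. (j a, restrict j A)) ((\<lambda>(l, j). j(a := l)) z) = z"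
    using assms(2) by (auto simp: multi_index_def fun_eq_iff PiE_iff extensional_def)
  show "\<forall>j\<in>multi_index (insert a A) k.
          (\<lambda>(l, j). j(a := l)) ((\<lambda>j. (j a, restrict j A)) j) = j"
    using assms(2) by (auto simp: multi_index_def fun_eq_iff PiE_iff extensional_def)
  show "(\<lambda>(l, j). j(a := l)) ` (SIGMA l:{..k}. multi_index A (k - l)) \<subseteq> multi_index (insert a A) k"
    using assms upd by (auto simp: multi_index_def PiE_iff extensional_def)
  show "(\<lambda>j. (j a, restrict j A)) ` multi_index (insert a A) k
          \<subseteq> (SIGMA l:{..k}. multi_index A (k - l))"
    using assms by (auto simp: multi_index_def PiE_iff)
qed

text \<open>By induction on the index set: the binomial theorem splits off the power of one new variable, and
  \<open>bij_betw_multi_index_insert\<close> absorbs its exponent into the multi-index.\<close>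

lemma multinomial_poly:
  fixes x :: "'i \<Rightarrow> 'c::field_char_0 poly"
  assumes "finite A"
  shows "(\<Sum>i\<in>A. x i) ^ k =
    (\<Sum>j\<in>multi_index A k. smult (fact k / (\<Prod>i\<in>A. fact (j i))) (\<Prod>i\<in>A. x i ^ j i))"
  using assms
proof (induction A arbitrary: k rule: finite_induct)
  case empty
  have "multi_index ({} :: 'i set) k = (if k = 0 then {\<lambda>_. undefined} else {})"
    by (auto simp: multi_index_def)
  then show ?case by simp
next
  case (insert a A)
  let ?t = "\<lambda>B k j. smult (fact k / (\<Prod>i\<in>B. fact (j i))) (\<Prod>i\<in>B. x i ^ j i)"
  have upd: "of_nat (k choose l) * x a ^ l * ?t A (k - l) j = ?t (insert a A) k (j(a := l))"
    if "l \<le> k" for l and j :: "'i \<Rightarrow> nat"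
  proof -
    have "(\<Prod>i\<in>A. fact ((j(a := l)) i)) = (\<Prod>i\<in>A. fact (j i) :: 'c)"
      "(\<Prod>i\<in>A. x i ^ (j(a := l)) i) = (\<Prod>i\<in>A. x i ^ j i)"
      using insert.hyps by (auto intro!: prod.cong)
    moreover have "(of_nat (k choose l) :: 'c) = fact k / (fact l * fact (k - l))"
      using that by (simp add: binomial_fact)
    moreover have "(of_nat (k choose l) :: 'c poly) = [:of_nat (k choose l):]"
      by (simp add: of_nat_poly)
    ultimately show ?thesis
      using insert.hyps by (simp add: mult_ac times_divide_eq_left)
  qed
  have "(\<Sum>i\<in>insert a A. x i) ^ k = (\<Sum>l\<le>k. of_nat (k choose l) * x a ^ l * (\<Sum>i\<in>A. x i) ^ (k - l))"
    using insert.hyps by (simp add: binomial_ring)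
  also have "\<dots> = (\<Sum>l\<le>k. \<Sum>j\<in>multi_index A (k - l). ?t (insert a A) k (j(a := l)))"
  proof (rule sum.cong)
    fix l assume "l \<in> {..k}"
    then have "l \<le> k" by simp
    show "of_nat (k choose l) * x a ^ l * (\<Sum>i\<in>A. x i) ^ (k - l) =
      (\<Sum>j\<in>multi_index A (k - l). ?t (insert a A) k (j(a := l)))"
      unfolding insert.IH sum_distrib_left using upd[OF \<open>l \<le> k\<close>] by (intro sum.cong) auto
  qed simp
  also have "\<dots> = (\<Sum>z\<in>(SIGMA l:{..k}. multi_index A (k - l)).
      ?t (insert a A) k ((\<lambda>(l, j). j(a := l)) z))"
    using insert.hyps by (subst sum.Sigma) (auto simp: finite_multi_index split_def)
  also have "\<dots> = (\<Sum>j\<in>multi_index (insert a A) k. ?t (insert a A) k j)"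
    by (rule sum.reindex_bij_betw[OF bij_betw_multi_index_insert[OF insert.hyps]])
  finally show ?case .
qed

text \<open>If the weight \<open>b i\<close> is attached to the monomial of degree \<open>i\<close>, then the product
  belonging to a multi-index \<open>j\<close> has degree \<open>\<Sum>i. i * j i\<close>. Keeping only the
  degrees below \<open>q\<close> is therefore the second condition in the definition of
  \<open>gamma_index\<close>.\<close>

lemma gamma_coeff_eq_coeff:
  assumes "1 \<le> q"
  shows "(\<Sum>s<q. coeff ((\<Sum>i=1..q-1. monom (b i) i) ^ k) s) = gamma_coeff b q k"
proof -
  have mon: "(\<Prod>i\<in>A. monom (b i) i ^ j i) = monom (\<Prod>i\<in>A. b i ^ j i) (\<Sum>i\<in>A. i * j i)"
    if "finite A" for A and j :: "nat \<Rightarrow> nat"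
    using that by induction (auto simp: monom_power mult_monom)
  have "(\<Sum>s<q. coeff ((\<Sum>i=1..q-1. monom (b i) i) ^ k) s) =
    (\<Sum>j\<in>multi_index {1..q-1} k. \<Sum>s<q. fact k / (\<Prod>i=1..q-1. fact (j i)) *
        coeff (monom (\<Prod>i=1..q-1. b i ^ j i) (\<Sum>i=1..q-1. i * j i)) s)"
    by (subst sum.swap) (simp add: multinomial_poly coeff_sum mon)
  also have "\<dots> = (\<Sum>j\<in>multi_index {1..q-1} k.
      if (\<Sum>i=1..q-1. i * j i) \<le> q - 1
      then fact k / (\<Prod>i=1..q-1. fact (j i)) * (\<Prod>i=1..q-1. b i ^ j i) else 0)"
    using assms by (intro sum.cong) (auto simp: sum_distrib_left[symmetric] sum_divide_distrib[symmetric])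
  also have "\<dots> = gamma_coeff b q k"
    unfolding gamma_coeff_def gamma_index_def multi_index_def
    by (subst sum.If_cases) (auto intro!: sum.cong simp: finite_multi_index[unfolded multi_index_def])
  finally show ?thesis .
qed

lemma gamma_coeff_0: "gamma_coeff b q 0 = 1"
proof -
  have "gamma_index q 0 = {\<lambda>i\<in>{1..q-1}. 0}"
    by (auto simp: gamma_index_def PiE_iff extensional_def fun_eq_iff)
  then show ?thesis by (simp add: gamma_coeff_def)
qed

text \<open>Each of the \<open>k\<close> factors contributes degree at least \<open>1\<close>.\<close>

lemma gamma_coeff_eq_0:
  assumes "q \<le> k" "1 \<le> q" shows "gamma_coeff b q k = 0"
proof -
  have "gamma_index q k = {}"
  proof safe
    fix j assume "j \<in> gamma_index q k"
    moreover have "(\<Sum>i=1..q-1. j i) \<le> (\<Sum>i=1..q-1. i * j i)"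
      by (intro sum_mono) auto
    ultimately show "j \<in> {}" using assms by (auto simp: gamma_index_def)
  qed
  then show ?thesis by (simp add: gamma_coeff_def)
qed

lemma abs_gamma_coeff_le:
  assumes "\<And>i. i \<in> {1..q-1} \<Longrightarrow> \<bar>b i\<bar> \<le> 1"
  shows "\<bar>gamma_coeff b q k\<bar> \<le> gamma_coeff (\<lambda>_. 1) q k"
  unfolding gamma_coeff_def
proof (rule sum_abs[THEN order_trans], rule sum_mono)
  fix j
  have "\<bar>\<Prod>i=1..q-1. b i ^ j i\<bar> \<le> 1"
    unfolding abs_prod power_abs using assms by (intro prod_le_1) (auto simp: power_le_one)
  then show "\<bar>fact k / (\<Prod>i=1..q-1. fact (j i)) * (\<Prod>i=1..q-1. b i ^ j i)\<bar>
      \<le> fact k / (\<Prod>i=1..q-1. fact (j i)) * (\<Prod>i=1..q-1. 1 ^ j i)"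
    by (simp add: abs_mult abs_prod divide_right_mono prod_nonneg mult_left_le)
qed

lemma tendsto_gamma_coeff:
  assumes "\<And>i. i \<in> {1..q-1} \<Longrightarrow> ((\<lambda>x. b x i) \<longlongrightarrow> \<beta> i) G"
  shows "((\<lambda>x. gamma_coeff (b x) q k) \<longlongrightarrow> gamma_coeff \<beta> q k) G"
  unfolding gamma_coeff_def
  by (intro tendsto_intros assms) auto

text \<open>The polynomial is the generating function, up to degree \<open>q - 1\<close>, of a count that is
  \<open>0\<close> with probability \<open>c\<close> and \<open>i\<close> with probability \<open>p * b
  i\<close>; its \<open>m\<close>-th power belongs to \<open>m\<close> independent copies. In the sum over
  \<open>k\<close>, the number of nonzero copies, the terms beyond \<open>q - 1\<close> have \<open>\<gamma> =
  0\<close> and those beyond \<open>m\<close> have a vanishing binomial coefficient.\<close>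

lemma sum_coeff_power_eq_gamma:
  assumes "1 \<le> q"
  shows "(\<Sum>s<q. coeff (([:c:] + smult p (\<Sum>i=1..q-1. monom (b i) i)) ^ m) s) =
     (\<Sum>k=0..q-1. real (m choose k) * c ^ (m - k) * p ^ k * gamma_coeff b q k)"
proof -
  let ?B = "\<Sum>i=1..q-1. monom (b i) i"
  have "([:c:] + smult p ?B) ^ m = (\<Sum>k\<le>m. of_nat (m choose k) * smult p ?B ^ k * [:c:] ^ (m - k))"
    by (subst add.commute) (rule binomial_ring)
  also have "\<dots> = (\<Sum>k\<le>m. smult (real (m choose k) * c ^ (m - k) * p ^ k) (?B ^ k))"
    by (intro sum.cong) (auto simp: of_nat_poly smult_power poly_const_pow mult_ac)
  finally have "(\<Sum>s<q. coeff (([:c:] + smult p ?B) ^ m) s) =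
    (\<Sum>k\<le>m. real (m choose k) * c ^ (m - k) * p ^ k * (\<Sum>s<q. coeff (?B ^ k) s))"
    by (simp add: coeff_sum sum_distrib_left sum.swap[of _ "{..<q}"])
  also have "\<dots> = (\<Sum>k\<le>m. real (m choose k) * c ^ (m - k) * p ^ k * gamma_coeff b q k)"
    by (simp only: gamma_coeff_eq_coeff[OF assms])
  also have "\<dots> = (\<Sum>k=0..max m (q-1). real (m choose k) * c ^ (m - k) * p ^ k * gamma_coeff b q k)"
    by (intro sum.mono_neutral_left) (auto simp: not_le)
  also have "\<dots> = (\<Sum>k=0..q-1. real (m choose k) * c ^ (m - k) * p ^ k * gamma_coeff b q k)"
    using assms by (intro sum.mono_neutral_right) (auto simp: not_le gamma_coeff_eq_0)
  finally show ?thesis .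
qed

section \<open>Binomial and Poisson terms, uniformly in the success probability\<close>

text \<open>\<open>a ^ L\<close> is the smallest of the first \<open>L + 1\<close> terms of the geometric series, whose
  sum is at most \<open>1 / (1 - a)\<close>. The point is that the bound does not depend on \<open>a\<close>.\<close>

lemma power_times_gap_le:
  fixes a :: real
  assumes "0 \<le> a" "a \<le> 1"
  shows "a ^ L * (1 - a) \<le> 1 / (real L + 1)"
proof -
  have "(real L + 1) * a ^ L = (\<Sum>i\<le>L. a ^ L)" by simp
  also have "\<dots> \<le> (\<Sum>i\<le>L. a ^ i)"
    using assms by (intro sum_mono power_decreasing) auto
  finally have "(real L + 1) * a ^ L * (1 - a) \<le> (\<Sum>i\<le>L. a ^ i) * (1 - a)"
    using assms by (intro mult_right_mono) auto
  also have "\<dots> = 1 - a ^ Suc L"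
    using one_diff_power_eq[of a "Suc L"] by (simp add: lessThan_Suc_atMost mult.commute)
  also have "\<dots> \<le> 1" using assms by simp
  finally show ?thesis by (simp add: field_simps)
qed

lemma power_times_exp_minus_le:
  fixes y :: real
  assumes "0 \<le> y"
  shows "y ^ k * exp (- y) \<le> fact k"
proof -
  have "y ^ k / fact k \<le> exp y"
    using sum_le_suminf[OF summable_exp_generic[of y], of "{k}"] assms
    by (auto simp: exp_def divide_inverse_commute)
  then show ?thesis by (simp add: field_simps exp_minus)
qed

text \<open>As a function of \<open>ln y\<close>, the expression \<open>y ^ k * exp (- y)\<close> has the bounded
  derivative \<open>k * y ^ k * exp (- y) - y ^ (k + 1) * exp (- y)\<close>, so a rescaling of \<open>y\<close>
  by a factor near \<open>1\<close> has a small effect for all \<open>y\<close> at once.\<close>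

lemma power_times_exp_minus_scale:
  fixes y c :: real
  assumes y: "0 \<le> y" and c: "1 / 2 \<le> c" "c \<le> 1"
  shows "\<bar>(c * y) ^ k * exp (- (c * y)) - y ^ k * exp (- y)\<bar>
           \<le> 2 * (real k * fact k + fact (Suc k)) * (1 - c)"
proof (cases "c * y = y")
  case True
  then show ?thesis using c by (auto intro!: mult_nonneg_nonneg add_nonneg_nonneg)
next
  case False
  then have "0 < y" "c * y < y" using y c by (auto simp: mult_le_cancel_right1 less_le)
  define f where "f = (\<lambda>y::real. y ^ k * exp (- y))"
  define f' where "f' = (\<lambda>y::real. k * y ^ (k - 1) * exp (- y) - y ^ k * exp (- y))"
  have "\<exists>z>c * y. z < y \<and> f y - f (c * y) = (y - c * y) * f' z"
    by (rule MVT2[OF \<open>c * y < y\<close>])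
      (auto simp: f_def f'_def intro!: derivative_eq_intros)
  then obtain z where z: "c * y < z" "z < y" "f y - f (c * y) = (y - c * y) * f' z" by blast
  have "0 < z" using z \<open>0 < y\<close> c by (intro le_less_trans[OF _ z(1)]) auto
  have "y \<le> 2 * z"
  proof -
    have "1 / 2 * y \<le> c * y" using c \<open>0 < y\<close> by (intro mult_right_mono) auto
    then show ?thesis using z by linarith
  qed
  have "z * f' z = real k * (z ^ k * exp (- z)) - z ^ Suc k * exp (- z)"
    by (cases k) (auto simp: f'_def algebra_simps)
  moreover have "real k * (z ^ k * exp (- z)) \<le> real k * fact k" "0 \<le> real k * (z ^ k * exp (- z))"
    "z ^ Suc k * exp (- z) \<le> fact (Suc k)" "0 \<le> z ^ Suc k * exp (- z)"
    using power_times_exp_minus_le[of z k] power_times_exp_minus_le[of z "Suc k"] \<open>0 < z\<close>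
    by (auto intro!: mult_left_mono simp del: fact_Suc)
  ultimately have *: "z * \<bar>f' z\<bar> \<le> real k * fact k + fact (Suc k)"
    using abs_mult[of z "f' z"] \<open>0 < z\<close> by linarith
  have "\<bar>f y - f (c * y)\<bar> = (1 - c) * (y * \<bar>f' z\<bar>)"
  proof -
    have "y - c * y = (1 - c) * y" by (simp add: algebra_simps)
    then show ?thesis unfolding z(3) using c \<open>0 < y\<close> by (simp add: abs_mult)
  qed
  also have "\<dots> \<le> (1 - c) * (2 * (z * \<bar>f' z\<bar>))"
    using c \<open>y \<le> 2 * z\<close> by (intro mult_left_mono) (auto intro: mult_right_mono simp: mult.assoc[symmetric])
  also have "\<dots> \<le> (1 - c) * (2 * (real k * fact k + fact (Suc k)))"
    using c * by (intro mult_left_mono) auto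
  finally show ?thesis by (simp add: f_def abs_minus_commute mult_ac)
qed

text \<open>In both terms \<open>a\<close> is the probability that a single trial contributes nothing. The Poisson mean
  \<open>- t * ln a\<close> is the one for which the outcome \<open>0\<close> has probability \<open>a powr
  t\<close>. Writing \<open>a powr t\<close> instead of \<open>exp (t * ln a)\<close> gives the term its limit
  \<open>0\<close> at \<open>a = 0\<close>.\<close>

definition binom_term :: "nat \<Rightarrow> nat \<Rightarrow> real \<Rightarrow> real" where
  "binom_term m k a = real (m choose k) * a ^ (m - k) * (1 - a) ^ k"

definition poisson_term :: "real \<Rightarrow> nat \<Rightarrow> real \<Rightarrow> real" where
  "poisson_term t k a = a powr t * (- (t * ln a)) ^ k / fact k"

lemma binom_term_nonneg: "0 \<le> a \<Longrightarrow> a \<le> 1 \<Longrightarrow> 0 \<le> binom_term m k a"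
  by (simp add: binom_term_def)

lemma binom_term_le: "0 \<le> a \<Longrightarrow> a \<le> 1 \<Longrightarrow> binom_term m k a \<le> real m ^ k * a ^ (m - k)"
proof -
  assume a: "0 \<le> a" "a \<le> 1"
  have "real (m choose k) \<le> real m ^ k"
    by (metis binomial_le_pow of_nat_le_iff of_nat_power binomial_eq_0 not_le of_nat_0 zero_le_power of_nat_0_le_iff)
  moreover have "(1 - a) ^ k \<le> 1" using a by (intro power_le_one) auto
  ultimately have "real (m choose k) * (1 - a) ^ k \<le> real m ^ k * 1"
    using a by (intro mult_mono) auto
  then have "real (m choose k) * (1 - a) ^ k * a ^ (m - k) \<le> real m ^ k * 1 * a ^ (m - k)"
    using a by (intro mult_right_mono) auto
  then show ?thesis by (simp add: binom_term_def mult_ac)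
qed

lemma binom_term_le_1:
  assumes "0 \<le> a" "a \<le> 1"
  shows "binom_term m k a \<le> 1"
proof (cases "k \<le> m")
  case True
  have "binom_term m k a \<le> (\<Sum>k\<le>m. binom_term m k a)"
    using True assms by (intro member_le_sum) (auto simp: binom_term_nonneg)
  also have "\<dots> = (1 - a + a) ^ m"
    unfolding binom_term_def by (subst binomial_ring) (simp add: mult_ac)
  finally show ?thesis by simp
qed (simp add: binom_term_def binomial_eq_0)

text \<open>For \<open>a = exp (- u)\<close> one has \<open>u * a \<le> 1 - a \<le> u\<close>, and \<open>fact k * (m
  choose k)\<close>, a product of \<open>k\<close> factors between \<open>m - k\<close> and \<open>m\<close>,
  lies between \<open>(m - k) ^ k\<close> and \<open>m ^ k\<close>.\<close>

lemma binom_term_bounds: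
  fixes u :: real
  assumes u: "0 \<le> u" and k: "k < m"
  defines "\<phi> \<equiv> \<lambda>y. y ^ k * exp (- y)"
  shows "fact k * binom_term m k (exp (- u)) \<le> (real m / (real m - real k)) ^ k * \<phi> ((real m - real k) * u)"
    and "((real m - real k) / real m) ^ k * \<phi> (real m * u) \<le> fact k * binom_term m k (exp (- u))"
proof -
  let ?a = "exp (- u)"
  have mk: "real (m - k) = real m - real k" "0 < real m - real k" using k by auto
  have "1 - ?a \<le> u" using exp_ge_add_one_self[of "- u"] by simp
  have "u * ?a \<le> 1 - ?a"
    using exp_ge_add_one_self[of u] by (simp add: exp_minus field_simps)
  have ea: "?a ^ j = exp (- (j * u))" for j :: nat
    by (simp add: exp_of_nat_mult[symmetric])
  have fb: "fact k * real (m choose k) = (\<Prod>i<k. real (m - i))"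
  proof -
    have "fact k * real (m choose k) = (\<Prod>i = 0..<k. real m - real i)"
      by (simp add: binomial_gbinomial gbinomial_mult_fact)
    also have "\<dots> = (\<Prod>i<k. real (m - i))"
      using k by (intro prod.cong) (auto simp: atLeast0LessThan of_nat_diff)
    finally show ?thesis .
  qed
  have up: "fact k * real (m choose k) \<le> real m ^ k"
  proof -
    have "(\<Prod>i<k. real (m - i)) \<le> (\<Prod>i<k. real m)" by (intro prod_mono) auto
    then show ?thesis by (simp add: fb)
  qed
  have lo: "(real m - real k) ^ k \<le> fact k * real (m choose k)"
  proof -
    have "(\<Prod>i<k. real (m - k)) \<le> (\<Prod>i<k. real (m - i))" by (intro prod_mono) auto
    then show ?thesis using k by (simp add: fb)
  qed
  have "fact k * binom_term m k ?a = (fact k * real (m choose k)) * (1 - ?a) ^ k * ?a ^ (m - k)"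
    by (simp add: binom_term_def)
  also have "\<dots> \<le> real m ^ k * u ^ k * ?a ^ (m - k)"
    using up \<open>1 - ?a \<le> u\<close> u by (intro mult_right_mono mult_mono power_mono) auto
  also have "\<dots> = (real m / (real m - real k)) ^ k * \<phi> ((real m - real k) * u)"
    using mk by (simp add: \<phi>_def ea power_mult_distrib power_divide)
  finally show "fact k * binom_term m k ?a \<le> (real m / (real m - real k)) ^ k * \<phi> ((real m - real k) * u)" .
  have "((real m - real k) / real m) ^ k * \<phi> (real m * u) = (real m - real k) ^ k * (u ^ k * ?a ^ m)"
    using mk k by (simp add: \<phi>_def ea power_mult_distrib power_divide)
  also have "?a ^ m = ?a ^ k * ?a ^ (m - k)" using k by (simp flip: power_add)
  also have "(real m - real k) ^ k * (u ^ k * (?a ^ k * ?a ^ (m - k))) = (real m - real k) ^ k * (u * ?a) ^ k * ?a ^ (m - k)"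
    by (simp add: power_mult_distrib)
  also have "\<dots> \<le> (fact k * real (m choose k)) * (1 - ?a) ^ k * ?a ^ (m - k)"
    using lo \<open>u * ?a \<le> 1 - ?a\<close> u mk by (intro mult_right_mono mult_mono power_mono) auto
  also have "\<dots> = fact k * binom_term m k ?a"
    by (simp add: binom_term_def)
  finally show "((real m - real k) / real m) ^ k * \<phi> (real m * u) \<le> fact k * binom_term m k ?a" .
qed

text \<open>With \<open>y = - t * ln a\<close> the bounds of \<open>binom_term_bounds\<close> are \<open>\<phi>\<close> at
  \<open>(m - k) / t * y\<close> and at \<open>m / t * y\<close>, up to factors close to \<open>1\<close>. The
  resulting error does not involve \<open>a\<close>.\<close>

lemma binom_term_minus_poisson_term_le:
  fixes t :: real
  assumes a: "0 \<le> a" "a \<le> 1" and m: "k < m" "real m \<le> t" "t / 2 \<le> real m - real k" "0 < t"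
  shows "\<bar>binom_term m k a - poisson_term t k a\<bar> \<le>
    ((real m / (real m - real k)) ^ k - 1) + (1 - ((real m - real k) / real m) ^ k)
     + 2 * (real k * fact k + fact (Suc k)) * (1 - (real m - real k) / t)"
proof (cases "a = 0")
  case True
  have "1 \<le> (real m / (real m - real k)) ^ k" "((real m - real k) / real m) ^ k \<le> 1" "(real m - real k) / t \<le> 1"
    using m by (auto intro!: one_le_power power_le_one)
  moreover have "0 \<le> 2 * (real k * fact k + fact (Suc k)) * (1 - (real m - real k) / t)"
    using m by (intro mult_nonneg_nonneg add_nonneg_nonneg) auto
  moreover have "binom_term m k a = 0" "poisson_term t k a = 0"
    using True m by (auto simp: binom_term_def poisson_term_def)
  ultimately show ?thesis by simp
next
  case False
  define u where "u = - ln a"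
  define \<phi> where "\<phi> y = y ^ k * exp (- y)" for y :: real
  define K where "K = 2 * (real k * fact k + fact (Suc k))"
  have "0 \<le> K" by (auto simp: K_def intro!: add_nonneg_nonneg)
  have u: "0 \<le> u" "a = exp (- u)" using a False by (auto simp: u_def)
  define y where "y = t * u"
  have "0 \<le> y" using u m by (simp add: y_def)
  have p: "fact k * poisson_term t k a = \<phi> y"
    using False by (simp add: poisson_term_def \<phi>_def y_def u(2) powr_def)
  define b where "b = fact k * binom_term m k a"
  define A where "A = (real m / (real m - real k)) ^ k"
  define B where "B = ((real m - real k) / real m) ^ k"
  have A: "1 \<le> A" and B: "B \<le> 1" "0 \<le> B" using m by (auto simp: A_def B_def intro!: one_le_power power_le_one)
  have c1: "(real m - real k) * u = (real m - real k) / t * y" and c2: "real m * u = real m / t * y"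
    using m by (auto simp: y_def)
  have b: "b \<le> A * \<phi> ((real m - real k) / t * y)" "B * \<phi> (real m / t * y) \<le> b"
    using binom_term_bounds[OF u(1) m(1)]
    by (simp_all only: b_def A_def B_def u(2) \<phi>_def c1 c2)
  have f: "0 \<le> \<phi> z \<and> \<phi> z \<le> fact k" if "0 \<le> z" for z
    using power_times_exp_minus_le[OF that] that by (auto simp: \<phi>_def)
  have s1: "\<bar>\<phi> ((real m - real k) / t * y) - \<phi> y\<bar> \<le> K * (1 - (real m - real k) / t)"
    unfolding \<phi>_def K_def using m by (intro power_times_exp_minus_scale \<open>0 \<le> y\<close>) (auto simp: field_simps)
  have s2: "\<bar>\<phi> (real m / t * y) - \<phi> y\<bar> \<le> K * (1 - real m / t)"
    unfolding \<phi>_def K_def using m by (intro power_times_exp_minus_scale \<open>0 \<le> y\<close>) (auto simp: field_simps)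
  have "K * (1 - real m / t) \<le> K * (1 - (real m - real k) / t)"
    using \<open>0 \<le> K\<close> m by (intro mult_left_mono) (auto simp: field_simps)
  note s2 = order_trans[OF s2 this]
  define P Q R where "P = \<phi> ((real m - real k) / t * y)" and "Q = \<phi> (real m / t * y)"
    and "R = K * (1 - (real m - real k) / t)"
  have "(A - 1) * P \<le> (A - 1) * fact k"
    using A f[of "(real m - real k) / t * y"] \<open>0 \<le> y\<close> m by (intro mult_left_mono) (auto simp: P_def)
  moreover have "(1 - B) * Q \<le> (1 - B) * fact k"
    using B f[of "real m / t * y"] \<open>0 \<le> y\<close> m by (intro mult_left_mono) (auto simp: Q_def)
  moreover have "(A - 1) * P = A * P - P" "(1 - B) * Q = Q - B * Q"
    by (simp_all add: left_diff_distrib)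
  moreover have "0 \<le> (A - 1) * fact k" "0 \<le> (1 - B) * fact k" using A B by auto
  moreover have "P - \<phi> y \<le> R" "- (Q - \<phi> y) \<le> R"
    using s1 s2 by (simp_all only: P_def Q_def R_def abs_le_iff)
  moreover have "b \<le> A * P" "B * Q \<le> b" using b by (simp_all only: P_def Q_def)
  ultimately have "b - \<phi> y \<le> (A - 1) * fact k + (1 - B) * fact k + R"
    "\<phi> y - b \<le> (A - 1) * fact k + (1 - B) * fact k + R"
    by linarith+
  then have "\<bar>b - \<phi> y\<bar> \<le> (A - 1) * fact k + (1 - B) * fact k + R"
    by (simp only: abs_le_iff minus_diff_eq)
  also have "R \<le> R * fact k"
    using \<open>0 \<le> K\<close> m mult_left_mono[of 1 "fact k" R] by (auto simp: fact_ge_1 R_def)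
  also have "(A - 1) * fact k + (1 - B) * fact k + R * fact k = fact k * (A - 1 + (1 - B) + R)"
    by (simp add: algebra_simps)
  also have "\<bar>b - \<phi> y\<bar> = fact k * \<bar>binom_term m k a - poisson_term t k a\<bar>"
    unfolding b_def p[symmetric] by (simp add: abs_mult flip: right_diff_distrib)
  finally have "\<bar>binom_term m k a - poisson_term t k a\<bar> \<le> A - 1 + (1 - B) + R"
    by simp
  then show ?thesis by (simp add: A_def B_def K_def R_def)
qed

lemma binom_term_tendsto_poisson_term:
  assumes "0 < (\<epsilon>::real)"
  shows "\<forall>\<^sub>F t in at_top. \<forall>a\<in>{0..1}. \<bar>binom_term (nat \<lfloor>t\<rfloor>) k a - poisson_term t k a\<bar> \<le> \<epsilon>"
proof -
  define bound where "bound t =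
    ((real (nat \<lfloor>t\<rfloor>) / (real (nat \<lfloor>t\<rfloor>) - k)) ^ k - 1) + (1 - ((real (nat \<lfloor>t\<rfloor>) - k) / real (nat \<lfloor>t\<rfloor>)) ^ k)
     + 2 * (real k * fact k + fact (Suc k)) * (1 - (real (nat \<lfloor>t\<rfloor>) - k) / t)" for t :: real
  have 1: "((\<lambda>t::real. real (nat \<lfloor>t\<rfloor>) / (real (nat \<lfloor>t\<rfloor>) - k)) \<longlongrightarrow> 1) at_top" by real_asymp
  have 2: "((\<lambda>t::real. (real (nat \<lfloor>t\<rfloor>) - k) / real (nat \<lfloor>t\<rfloor>)) \<longlongrightarrow> 1) at_top" by real_asymp
  have 3: "((\<lambda>t::real. (real (nat \<lfloor>t\<rfloor>) - k) / t) \<longlongrightarrow> 1) at_top" by real_asymp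
  have "(bound \<longlongrightarrow> (1 ^ k - 1) + (1 - 1 ^ k) + 2 * (real k * fact k + fact (Suc k)) * (1 - 1)) at_top"
    unfolding bound_def by (intro tendsto_intros 1 2 3)
  then have "\<forall>\<^sub>F t in at_top. bound t < \<epsilon>"
    using assms by (intro order_tendstoD(2)) auto
  moreover have "\<forall>\<^sub>F t::real in at_top. t / 2 \<le> real (nat \<lfloor>t\<rfloor>) - k" by real_asymp
  moreover have "\<forall>\<^sub>F t::real in at_top. 0 < t" by real_asymp
  ultimately show ?thesis
  proof eventually_elim
    case (elim t)
    then have "\<bar>binom_term (nat \<lfloor>t\<rfloor>) k a - poisson_term t k a\<bar> \<le> bound t" if "a \<in> {0..1}" for a
      unfolding bound_def using that
      by (intro binom_term_minus_poisson_term_le) auto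
    then show ?case using elim(1) by fastforce
  qed
qed

lemma power_times_geometric_tendsto_0:
  fixes a :: real
  assumes "0 \<le> a" "a < 1"
  shows "(\<lambda>m. real m ^ k * a ^ (m - k)) \<longlonglongrightarrow> 0"
proof -
  \<comment> \<open>A positive base, so that \<open>b ^ (m - k)\<close> is \<open>b ^ m / b ^ k\<close>.\<close>
  define b where "b = max a (1 / 2)"
  have b: "0 < b" "b < 1" "a \<le> b" using assms by (auto simp: b_def)
  have "(\<lambda>m. real m ^ k * b ^ (m - k)) \<longlonglongrightarrow> 0"
  proof -
    have "(\<lambda>m. real m ^ k * b ^ m) \<longlonglongrightarrow> 0" using b by real_asymp
    then have "(\<lambda>m. real m ^ k * b ^ m / b ^ k) \<longlonglongrightarrow> 0 / b ^ k"
      using b by (intro tendsto_intros) auto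
    moreover have "\<forall>\<^sub>F m in sequentially. real m ^ k * b ^ m / b ^ k = real m ^ k * b ^ (m - k)"
      using eventually_ge_at_top[of k] by eventually_elim (use b in \<open>simp add: power_diff\<close>)
    ultimately show ?thesis by (auto dest: Lim_transform_eventually)
  qed
  then show ?thesis
    by (rule Lim_null_comparison[rotated])
      (use assms b in \<open>auto intro!: always_eventually mult_left_mono power_mono\<close>)
qed

section \<open>A weak law of large numbers\<close>

text \<open>Only a first moment is available, so the variables are split into \<open>U = min Y K\<close> and the excess
  \<open>V = Y - U\<close>. The bounded part obeys Hoeffding's inequality; the excess has mean at most
  \<open>\<eta>\<close> for large \<open>K\<close>, so that its sum is controlled by Markov's inequality.\<close>

lemma (in prob_space) weak_law_of_large_numbers:
  fixes Y :: "nat \<Rightarrow> 'a \<Rightarrow> real" and \<epsilon> :: real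
  assumes indep: "indep_vars (\<lambda>_. borel) Y {1..}"
    and nonneg: "\<And>j \<omega>. \<omega> \<in> space M \<Longrightarrow> 0 \<le> Y j \<omega>"
    and ident: "\<And>j. 1 \<le> j \<Longrightarrow> distr M borel (Y j) = distr M borel (Y 1)"
    and integrable_Y: "integrable M (Y 1)"
    and "0 < \<epsilon>"
  shows "(\<lambda>m. \<P>(\<omega> in M. \<epsilon> * m \<le> \<bar>(\<Sum>j=1..m. Y j \<omega>) - m * expectation (Y 1)\<bar>)) \<longlonglongrightarrow> 0"
proof -
  have meas[measurable]: "Y j \<in> borel_measurable M" if "1 \<le> j" for j
    using indep that by (auto simp: indep_vars_def)
  have int_Y: "integrable M (Y j)" if "1 \<le> j" for j
  proof -
    have "integrable M (Y j) \<longleftrightarrow> integrable (distr M borel (Y j)) (\<lambda>y. y)"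
      using that by (intro integrable_distr_eq[symmetric]) auto
    also have "\<dots> \<longleftrightarrow> integrable (distr M borel (Y 1)) (\<lambda>y. y)"
      by (simp only: ident[OF that])
    also have "\<dots> \<longleftrightarrow> integrable M (Y 1)"
      by (intro integrable_distr_eq) auto
    finally show ?thesis using integrable_Y by blast
  qed
  have exp_eq: "expectation (\<lambda>\<omega>. g (Y j \<omega>)) = expectation (\<lambda>\<omega>. g (Y 1 \<omega>))"
    if g: "g \<in> borel_measurable borel" and "1 \<le> j" for g :: "real \<Rightarrow> real" and j
  proof -
    have "expectation (\<lambda>\<omega>. g (Y j \<omega>)) = integral\<^sup>L (distr M borel (Y j)) g"
      using that by (intro integral_distr[symmetric]) auto
    also have "\<dots> = integral\<^sup>L (distr M borel (Y 1)) g"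
      by (simp only: ident[OF \<open>1 \<le> j\<close>])
    also have "\<dots> = expectation (\<lambda>\<omega>. g (Y 1 \<omega>))"
      using g by (intro integral_distr) auto
    finally show ?thesis .
  qed
  have trunc: "(\<lambda>K. expectation (\<lambda>\<omega>. min (Y 1 \<omega>) (real K))) \<longlonglongrightarrow> expectation (Y 1)"
  proof (rule integral_dominated_convergence[where w = "Y 1"])
    show "AE \<omega> in M. (\<lambda>K. min (Y 1 \<omega>) (real K)) \<longlonglongrightarrow> Y 1 \<omega>"
    proof (intro always_eventually allI)
      fix \<omega>
      have "\<forall>\<^sub>F K in sequentially. Y 1 \<omega> \<le> real K"
        using filterlim_real_sequentially by (auto simp: filterlim_at_top)
      then have "\<forall>\<^sub>F K in sequentially. min (Y 1 \<omega>) (real K) = Y 1 \<omega>"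
        by eventually_elim simp
      then show "(\<lambda>K. min (Y 1 \<omega>) (real K)) \<longlonglongrightarrow> Y 1 \<omega>" by (rule tendsto_eventually)
    qed
    show "AE \<omega> in M. norm (min (Y 1 \<omega>) (real K)) \<le> Y 1 \<omega>" for K
      using nonneg by (intro AE_I2) auto
  qed (use integrable_Y in auto)
  let ?D = "\<lambda>m \<omega>. \<bar>(\<Sum>j=1..m. Y j \<omega>) - m * expectation (Y 1)\<bar>"
  show ?thesis
  proof (rule LIMSEQ_I)
    fix e :: real assume "0 < e"
    \<comment> \<open>The first bound makes the centring of the excess negligible, the second one serves Markov's inequality.\<close>
    define \<eta> where "\<eta> = min (\<epsilon> / 4) (\<epsilon> * e / 8)"
    have \<eta>: "0 < \<eta>" "\<eta> \<le> \<epsilon> / 4" "\<eta> \<le> \<epsilon> * e / 8"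
      using \<open>0 < \<epsilon>\<close> \<open>0 < e\<close> by (auto simp: \<eta>_def)
    have "\<forall>\<^sub>F K in sequentially. expectation (Y 1) - \<eta> < expectation (\<lambda>\<omega>. min (Y 1 \<omega>) (real K)) \<and> 0 < K"
      by (intro eventually_conj order_tendstoD(1)[OF trunc] eventually_gt_at_top) (use \<eta> in auto)
    then obtain K :: nat where
      K: "expectation (Y 1) - \<eta> < expectation (\<lambda>\<omega>. min (Y 1 \<omega>) (real K))" "0 < K"
      using eventually_happens by fastforce
    define U where "U j \<omega> = min (Y j \<omega>) (real K)" for j \<omega>
    define V where "V j \<omega> = Y j \<omega> - U j \<omega>" for j \<omega>
    define u v where "u = expectation (U 1)" and "v = expectation (V 1)"
    have [measurable]: "U j \<in> borel_measurable M" "V j \<in> borel_measurable M" if "1 \<le> j" for j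
      using that by (auto simp: U_def[abs_def] V_def[abs_def])
    have U: "0 \<le> U j \<omega>" "U j \<omega> \<le> K" "0 \<le> V j \<omega>" if "\<omega> \<in> space M" for j \<omega>
      using nonneg[OF that] by (auto simp: U_def V_def)
    have int_U: "integrable M (U j)" if "1 \<le> j" for j
      using that U by (intro integrable_const_bound[where B = K]) auto
    have int_V: "integrable M (V j)" if "1 \<le> j" for j
      unfolding V_def using that int_U int_Y by auto
    have exp_U: "expectation (U j) = u" if "1 \<le> j" for j
      unfolding u_def U_def by (rule exp_eq) (use that in auto)
    have exp_V: "expectation (V j) = v" if "1 \<le> j" for j
      unfolding v_def V_def U_def by (rule exp_eq) (use that in auto)
    have uv: "expectation (Y 1) = u + v"
      unfolding u_def v_def V_def using int_U int_Y by simp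
    have v: "v \<le> \<eta>" using K(1) uv unfolding u_def U_def by linarith
    have tail: "\<P>(\<omega> in M. \<epsilon> * m / 2 \<le> (\<Sum>j=1..m. V j \<omega>)) \<le> e / 4" if "0 < m" for m
    proof -
      have "\<P>(\<omega> in M. \<epsilon> * m / 2 \<le> (\<Sum>j=1..m. V j \<omega>)) \<le> expectation (\<lambda>\<omega>. \<Sum>j=1..m. V j \<omega>) / (\<epsilon> * m / 2)"
        using that \<open>0 < \<epsilon>\<close> U int_V
        by (intro integral_Markov_inequality_measure[where A = "{}"] AE_I2 sum_nonneg) auto
      also have "expectation (\<lambda>\<omega>. \<Sum>j=1..m. V j \<omega>) = m * v"
        using int_V exp_V by simp
      also have "m * v / (\<epsilon> * m / 2) = 2 * v / \<epsilon>" using that by simp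
      also have "\<dots> \<le> e / 4"
        using v \<eta> \<open>0 < \<epsilon>\<close> by (simp add: field_simps)
      finally show ?thesis .
    qed
    have bulk: "\<P>(\<omega> in M. \<epsilon> * m / 2 \<le> \<bar>(\<Sum>j=1..m. U j \<omega>) - m * u\<bar>) \<le> 2 * exp (- real m * (\<epsilon>\<^sup>2 / (2 * K\<^sup>2)))"
      if "0 < m" for m
    proof -
      interpret Hoeffding_ineq M "{1..m}" U "\<lambda>_. 0" "\<lambda>_. real K" "m * u"
      proof unfold_locales
        show "indep_vars (\<lambda>_. borel) U {1..m}"
          unfolding U_def
          by (rule indep_vars_compose2[OF indep_vars_subset[OF indep]]) auto
        show "AE \<omega> in M. U i \<omega> \<in> {0..real K}" for i
          using U by (intro AE_I2) auto
        show "m * u \<equiv> \<Sum>i\<in>{1..m}. expectation (U i)"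
          by (rule eq_reflection) (simp add: exp_U)
      qed auto
      have "\<P>(\<omega> in M. \<epsilon> * m / 2 \<le> \<bar>(\<Sum>j=1..m. U j \<omega>) - m * u\<bar>)
        \<le> 2 * exp (-2 * (\<epsilon> * m / 2)\<^sup>2 / (\<Sum>i\<in>{1..m}. (real K - 0)\<^sup>2))"
        by (rule Hoeffding_ineq_abs_ge) (use that K \<open>0 < \<epsilon>\<close> in auto)
      also have "-2 * (\<epsilon> * m / 2)\<^sup>2 / (\<Sum>i\<in>{1..m}. (real K - 0)\<^sup>2) = - real m * (\<epsilon>\<^sup>2 / (2 * K\<^sup>2))"
        using that by (simp add: power2_eq_square field_simps)
      finally show ?thesis .
    qed
    have main: "\<P>(\<omega> in M. \<epsilon> * m \<le> ?D m \<omega>) \<le> 2 * exp (- real m * (\<epsilon>\<^sup>2 / (2 * K\<^sup>2))) + e / 4" if "0 < m" for m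
    proof -
      have "\<epsilon> * m / 2 \<le> \<bar>(\<Sum>j=1..m. U j \<omega>) - m * u\<bar> \<or> \<epsilon> * m / 2 \<le> (\<Sum>j=1..m. V j \<omega>)"
        if "\<omega> \<in> space M" "\<epsilon> * m \<le> ?D m \<omega>" for \<omega>
      proof -
        have "(\<Sum>j=1..m. Y j \<omega>) = (\<Sum>j=1..m. U j \<omega>) + (\<Sum>j=1..m. V j \<omega>)"
          by (simp add: V_def sum_subtractf)
        moreover have "0 \<le> (\<Sum>j=1..m. V j \<omega>)" using U that by (intro sum_nonneg) auto
        moreover have "m * v \<le> m * (\<epsilon> / 4)" using v \<eta> by (intro mult_left_mono) auto
        moreover have "0 \<le> v" unfolding v_def using U by (intro Bochner_Integration.integral_nonneg) auto
        then have "0 \<le> m * v" by simp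
        moreover have "0 \<le> \<epsilon> * m" using \<open>0 < \<epsilon>\<close> by simp
        moreover have "m * expectation (Y 1) = m * u + m * v" unfolding uv by (rule distrib_left)
        ultimately show ?thesis using that(2) by argo
      qed
      then have "\<P>(\<omega> in M. \<epsilon> * m \<le> ?D m \<omega>) \<le>
        prob ({\<omega>\<in>space M. \<epsilon> * m / 2 \<le> \<bar>(\<Sum>j=1..m. U j \<omega>) - m * u\<bar>} \<union>
              {\<omega>\<in>space M. \<epsilon> * m / 2 \<le> (\<Sum>j=1..m. V j \<omega>)})"
        by (intro finite_measure_mono) auto
      also have "\<dots> \<le> \<P>(\<omega> in M. \<epsilon> * m / 2 \<le> \<bar>(\<Sum>j=1..m. U j \<omega>) - m * u\<bar>)
          + \<P>(\<omega> in M. \<epsilon> * m / 2 \<le> (\<Sum>j=1..m. V j \<omega>))"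
        by (intro measure_Un_le) auto
      also have "\<dots> \<le> 2 * exp (- real m * (\<epsilon>\<^sup>2 / (2 * K\<^sup>2))) + e / 4"
        using bulk[OF that] tail[OF that] by simp
      finally show ?thesis .
    qed
    have "(\<lambda>m. 2 * exp (- real m * (\<epsilon>\<^sup>2 / (2 * K\<^sup>2)))) \<longlonglongrightarrow> 2 * 0"
    proof (intro tendsto_mult tendsto_const)
      have "0 < \<epsilon>\<^sup>2 / (2 * K\<^sup>2)" using K \<open>0 < \<epsilon>\<close> by simp
      then have "filterlim (\<lambda>m. \<epsilon>\<^sup>2 / (2 * K\<^sup>2) * real m) at_top sequentially"
        by (intro filterlim_tendsto_pos_mult_at_top[OF tendsto_const] filterlim_real_sequentially)
      then have "(\<lambda>m. exp (- (\<epsilon>\<^sup>2 / (2 * K\<^sup>2) * real m))) \<longlonglongrightarrow> 0"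
        by (intro filterlim_compose[OF exp_at_bot] filterlim_uminus_at_bot[THEN iffD2]) (simp add: minus_minus)
      then show "(\<lambda>m. exp (- real m * (\<epsilon>\<^sup>2 / (2 * K\<^sup>2)))) \<longlonglongrightarrow> 0"
        by (simp add: mult.commute)
    qed
    then have "\<forall>\<^sub>F m in sequentially. 2 * exp (- real m * (\<epsilon>\<^sup>2 / (2 * K\<^sup>2))) < e / 2"
      by (rule order_tendstoD(2)) (use \<open>0 < e\<close> in simp)
    then have "\<forall>\<^sub>F m in sequentially. norm (\<P>(\<omega> in M. \<epsilon> * m \<le> ?D m \<omega>) - 0) < e"
      using eventually_gt_at_top[of 0]
    proof eventually_elim
      case (elim m)
      then show ?case using main[of m] \<open>0 < e\<close> by (simp add: measure_nonneg)
    qed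
    then show "\<exists>no. \<forall>m\<ge>no. norm (\<P>(\<omega> in M. \<epsilon> * m \<le> ?D m \<omega>) - 0) < e"
      by (simp add: eventually_sequentially)
  qed
qed

lemma (in prob_space) prob_real_nat_gt_tendsto_0:
  fixes Z :: "'a \<Rightarrow> nat" and c :: real
  assumes [measurable]: "Z \<in> measurable M (count_space UNIV)" and "0 < c"
  shows "(\<lambda>n. \<P>(\<omega> in M. c * real n < real (Z \<omega>))) \<longlonglongrightarrow> 0"
proof -
  have "(\<lambda>n. prob {\<omega>\<in>space M. c * real n < real (Z \<omega>)}) \<longlonglongrightarrow> prob (\<Inter>n. {\<omega>\<in>space M. c * real n < real (Z \<omega>)})"
  proof (rule finite_Lim_measure_decseq)
    show "decseq (\<lambda>n. {\<omega>\<in>space M. c * real n < real (Z \<omega>)})"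
      using \<open>0 < c\<close> by (auto simp: decseq_def elim!: le_less_trans[rotated] intro!: mult_left_mono)
  qed auto
  also have "(\<Inter>n. {\<omega>\<in>space M. c * real n < real (Z \<omega>)}) = {}"
  proof -
    have "\<exists>n. \<not> c * real n < real (Z \<omega>)" for \<omega>
      using reals_Archimedean3[OF \<open>0 < c\<close>] by (metis mult.commute not_less_iff_gr_or_eq)
    then show ?thesis by blast
  qed
  finally show ?thesis by simp
qed

section \<open>Partial sums of independent counts\<close>

text \<open>Among \<open>q\<close> disjoint blocks of length \<open>m div q\<close>, each nonzero block contributes at
  least \<open>1\<close> to the sum.\<close>

lemma ex_zero_block:
  fixes e :: "nat \<Rightarrow> nat"
  assumes "(\<Sum>j=1..m. e j) < q"
  shows "\<exists>b<q. \<forall>j\<in>{b * (m div q)..<b * (m div q) + m div q}. e (Suc j) = 0"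
proof (rule ccontr)
  let ?B = "\<lambda>b. {b * (m div q)..<b * (m div q) + m div q}"
  assume "\<not> ?thesis"
  then have "\<forall>b<q. \<exists>j\<in>?B b. 1 \<le> e (Suc j)" by (auto simp: Suc_le_eq)
  then have "1 \<le> (\<Sum>j\<in>?B b. e (Suc j))" if "b < q" for b
    using that by (meson finite_atLeastLessThan member_le_sum order_trans zero_le)
  then have "(\<Sum>b<q. 1) \<le> (\<Sum>b<q. \<Sum>j\<in>?B b. e (Suc j))"
    by (intro sum_mono) auto
  also have "\<dots> = (\<Sum>j<q * (m div q). e (Suc j))"
    by (rule sum.nat_group)
  also have "\<dots> \<le> (\<Sum>j<m. e (Suc j))"
    by (intro sum_mono2) (auto intro: less_le_trans)
  also have "\<dots> = (\<Sum>j=1..m. e j)"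
    by (simp add: sum.atLeast1_atMost_eq)
  finally show False using assms by simp
qed

definition partial_sum :: "(nat \<Rightarrow> 'a \<Rightarrow> nat) \<Rightarrow> nat \<Rightarrow> 'a \<Rightarrow> nat" where
  "partial_sum E m \<omega> = (\<Sum>j=1..m. E j \<omega>)"

text \<open>The variable \<open>E 0\<close> is independent of the others but may have a law of its own: it stands for the
  initial cycle, and partial sums start with \<open>E 1\<close>.\<close>

locale iid_counts = prob_space +
  fixes E :: "nat \<Rightarrow> 'a \<Rightarrow> nat"
  assumes indep: "indep_vars (\<lambda>_. count_space UNIV) E UNIV"
    and ident: "\<And>j i. 1 \<le> j \<Longrightarrow> \<P>(\<omega> in M. E j \<omega> = i) = \<P>(\<omega> in M. E 1 \<omega> = i)"
begin

lemma measurable_E[measurable]: "E j \<in> measurable M (count_space UNIV)"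
  using indep by (auto simp: indep_vars_def)

lemma measurable_partial_sum[measurable]: "partial_sum E m \<in> measurable M (count_space UNIV)"
  unfolding partial_sum_def by measurable

lemma prob_all:
  assumes "finite J"
  shows "\<P>(\<omega> in M. \<forall>j\<in>J. E j \<omega> \<in> A j) = (\<Prod>j\<in>J. \<P>(\<omega> in M. E j \<omega> \<in> A j))"
proof (cases "J = {}")
  case True
  then show ?thesis by (simp add: prob_space)
next
  case False
  have "prob (\<Inter>j\<in>J. E j -` A j \<inter> space M) = (\<Prod>j\<in>J. prob (E j -` A j \<inter> space M))"
    by (rule indep_varsD[OF indep False assms]) auto
  also have "(\<Inter>j\<in>J. E j -` A j \<inter> space M) = {\<omega>\<in>space M. \<forall>j\<in>J. E j \<omega> \<in> A j}"
    using False by auto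
  finally show ?thesis by (simp add: vimage_def Int_def conj_commute)
qed

text \<open>Convolution of laws is multiplication of generating functions. As the coefficient of degree \<open>s\<close>
  of a product involves no higher degrees, \<open>W\<close> has to be correct only up to degree
  \<open>s\<close>, and a polynomial suffices for any law.\<close>

lemma prob_partial_sum_eq_coeff:
  assumes "\<And>i. i \<le> s \<Longrightarrow> coeff W i = \<P>(\<omega> in M. E 1 \<omega> = i)"
  shows "\<P>(\<omega> in M. partial_sum E m \<omega> = s) = coeff (W ^ m) s"
  using assms
proof (induction m arbitrary: s)
  case 0
  then show ?case by (auto simp: partial_sum_def prob_space coeff_1)
next
  case (Suc m)
  have "indep_vars (\<lambda>_. borel) (\<lambda>j \<omega>. real (E j \<omega>)) (insert (Suc m) {1..m})"
    by (rule indep_vars_compose2[OF indep_vars_subset[OF indep]]) auto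
  then have ind: "indep_var borel (\<lambda>\<omega>. real (E (Suc m) \<omega>)) borel (\<lambda>\<omega>. \<Sum>j\<in>{1..m}. real (E j \<omega>))"
    by (intro indep_vars_sum) auto
  have split: "\<P>(\<omega> in M. E (Suc m) \<omega> = i \<and> partial_sum E m \<omega> = l) =
      \<P>(\<omega> in M. E (Suc m) \<omega> = i) * \<P>(\<omega> in M. partial_sum E m \<omega> = l)" for i l
  proof -
    have "(real (E (Suc m) \<omega>) = real i) = (E (Suc m) \<omega> = i)"
      "((\<Sum>j\<in>{1..m}. real (E j \<omega>)) = real l) = (partial_sum E m \<omega> = l)" for \<omega>
      unfolding partial_sum_def of_nat_sum[symmetric] of_nat_eq_iff by simp_all
    then show ?thesis
      using indep_varD[OF ind, of "{real i}" "{real l}"]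
      by (simp add: vimage_def Int_def conj_commute)
  qed
  have "\<P>(\<omega> in M. partial_sum E (Suc m) \<omega> = s) =
      prob (\<Union>i\<in>{..s}. {\<omega>\<in>space M. E (Suc m) \<omega> = i \<and> partial_sum E m \<omega> = s - i})"
    by (intro arg_cong[where f = prob]) (auto simp: partial_sum_def)
  also have "\<dots> = (\<Sum>i\<le>s. \<P>(\<omega> in M. E (Suc m) \<omega> = i \<and> partial_sum E m \<omega> = s - i))"
    by (intro finite_measure_finite_Union) (auto simp: disjoint_family_on_def)
  also have "\<dots> = (\<Sum>i\<le>s. coeff W i * coeff (W ^ m) (s - i))"
    using Suc by (intro sum.cong) (auto simp: split ident[of "Suc m"])
  also have "\<dots> = coeff (W ^ Suc m) s"
    by (simp add: coeff_mult)
  finally show ?case .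
qed

lemma prob_block_free:
  fixes B :: "nat set"
  assumes "finite B" "i \<notin> Suc ` B"
  shows "\<P>(\<omega> in M. (\<forall>j\<in>B. E (Suc j) \<omega> = 0) \<and> E i \<omega> \<noteq> 0) =
    \<P>(\<omega> in M. E 1 \<omega> = 0) ^ card B * \<P>(\<omega> in M. E i \<omega> \<noteq> 0)"
proof -
  define A where "A j = (if j = i then UNIV - {0} else {0 :: nat})" for j
  have "\<P>(\<omega> in M. (\<forall>j\<in>B. E (Suc j) \<omega> = 0) \<and> E i \<omega> \<noteq> 0) =
      \<P>(\<omega> in M. \<forall>j\<in>insert i (Suc ` B). E j \<omega> \<in> A j)"
    using assms(2) by (intro arg_cong[where f = prob]) (auto simp: A_def)
  also have "\<dots> = \<P>(\<omega> in M. E i \<omega> \<noteq> 0) * (\<Prod>j\<in>Suc ` B. \<P>(\<omega> in M. E j \<omega> \<in> A j))"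
    using assms by (subst prob_all) (auto simp: A_def)
  also have "(\<Prod>j\<in>Suc ` B. \<P>(\<omega> in M. E j \<omega> \<in> A j)) = (\<Prod>j\<in>Suc ` B. \<P>(\<omega> in M. E 1 \<omega> = 0))"
  proof (intro prod.cong refl)
    fix j assume "j \<in> Suc ` B"
    then have "1 \<le> j" "A j = {0}" using assms(2) by (auto simp: A_def)
    then show "\<P>(\<omega> in M. E j \<omega> \<in> A j) = \<P>(\<omega> in M. E 1 \<omega> = 0)"
      using ident[of j 0] by simp
  qed
  also have "\<dots> = \<P>(\<omega> in M. E 1 \<omega> = 0) ^ card B"
    by (simp add: card_image)
  finally show ?thesis by simp
qed

text \<open>By \<open>ex_zero_block\<close>, one of \<open>q\<close> blocks is free of exceedances. The index
  \<open>i\<close> lies outside all the blocks, so that the two requirements are independent.\<close>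

lemma prob_partial_sum_less_and_exceed_le:
  assumes "i = 0 \<or> m < i"
  shows "\<P>(\<omega> in M. partial_sum E m \<omega> < q \<and> E i \<omega> \<noteq> 0)
    \<le> q * (\<P>(\<omega> in M. E 1 \<omega> = 0) ^ (m div q) * \<P>(\<omega> in M. E i \<omega> \<noteq> 0))"
proof -
  define B where "B b = {b * (m div q)..<b * (m div q) + m div q}" for b
  have "i \<notin> Suc ` B b" if "b < q" for b
  proof -
    have "b * (m div q) + m div q \<le> q * (m div q)"
      using that mult_le_mono1[of "Suc b" q "m div q"] by simp
    also have "\<dots> \<le> m" by simp
    finally show ?thesis using assms by (auto simp: B_def)
  qed
  note notin = this
  have "\<P>(\<omega> in M. partial_sum E m \<omega> < q \<and> E i \<omega> \<noteq> 0) \<le>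
      prob (\<Union>b\<in>{..<q}. {\<omega>\<in>space M. (\<forall>j\<in>B b. E (Suc j) \<omega> = 0) \<and> E i \<omega> \<noteq> 0})"
    using ex_zero_block unfolding partial_sum_def B_def
    by (intro finite_measure_mono) (auto, blast)
  also have "\<dots> \<le> (\<Sum>b<q. \<P>(\<omega> in M. (\<forall>j\<in>B b. E (Suc j) \<omega> = 0) \<and> E i \<omega> \<noteq> 0))"
    by (intro finite_measure_subadditive_finite) (auto simp: B_def)
  also have "\<dots> = (\<Sum>b<q. \<P>(\<omega> in M. E 1 \<omega> = 0) ^ (m div q) * \<P>(\<omega> in M. E i \<omega> \<noteq> 0))"
    using notin by (intro sum.cong refl, subst prob_block_free) (auto simp: B_def)
  finally show ?thesis by simp
qed

text \<open>Reaching \<open>q\<close> between \<open>m\<close> and \<open>m'\<close> needs a nonzero count at one of the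
  \<open>m' - m\<close> indices in between; each of them is covered by
  \<open>prob_partial_sum_less_and_exceed_le\<close> and \<open>power_times_gap_le\<close>. The law of the
  counts has disappeared from the bound.\<close>

lemma prob_partial_sum_crosses_le:
  assumes "m \<le> m'"
  shows "\<P>(\<omega> in M. partial_sum E m \<omega> < q \<and> q \<le> partial_sum E m' \<omega>) \<le> real q * real (m' - m) / (m div q + 1)"
proof -
  let ?a = "\<P>(\<omega> in M. E 1 \<omega> = 0)"
  have compl: "\<P>(\<omega> in M. E i \<omega> \<noteq> 0) = 1 - ?a" if "1 \<le> i" for i
    by (subst prob_neg) (auto simp: ident[OF that])
  have "\<exists>i\<in>{m<..m'}. E i \<omega> \<noteq> 0" if "partial_sum E m \<omega> < q" "q \<le> partial_sum E m' \<omega>" for \<omega>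
  proof (rule ccontr)
    assume "\<not> ?thesis"
    then have "(\<Sum>i\<in>{1..m'} - {1..m}. E i \<omega>) = 0" by auto
    then have "partial_sum E m' \<omega> = partial_sum E m \<omega>"
      using assms sum.subset_diff[of "{1..m}" "{1..m'}" "\<lambda>i. E i \<omega>"] by (simp add: partial_sum_def)
    then show False using that by simp
  qed
  then have "\<P>(\<omega> in M. partial_sum E m \<omega> < q \<and> q \<le> partial_sum E m' \<omega>) \<le>
      prob (\<Union>i\<in>{m<..m'}. {\<omega>\<in>space M. partial_sum E m \<omega> < q \<and> E i \<omega> \<noteq> 0})"
    by (intro finite_measure_mono) auto
  also have "\<dots> \<le> (\<Sum>i\<in>{m<..m'}. \<P>(\<omega> in M. partial_sum E m \<omega> < q \<and> E i \<omega> \<noteq> 0))"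
    by (intro finite_measure_subadditive_finite) auto
  also have "\<dots> \<le> (\<Sum>i\<in>{m<..m'}. q * (1 / (m div q + 1)))"
  proof (rule sum_mono)
    fix i assume i: "i \<in> {m<..m'}"
    have "\<P>(\<omega> in M. partial_sum E m \<omega> < q \<and> E i \<omega> \<noteq> 0) \<le> q * (?a ^ (m div q) * \<P>(\<omega> in M. E i \<omega> \<noteq> 0))"
      using i by (intro prob_partial_sum_less_and_exceed_le) auto
    also have "\<dots> \<le> q * (1 / (m div q + 1))"
      using i compl[of i] power_times_gap_le[of ?a "m div q"] by (intro mult_left_mono) (auto simp: add.commute)
    finally show "\<P>(\<omega> in M. partial_sum E m \<omega> < q \<and> E i \<omega> \<noteq> 0) \<le> q * (1 / (m div q + 1))" .
  qed
  finally show ?thesis by (simp add: mult.commute)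
qed

lemma prob_partial_sum_less_eq:
  assumes "1 \<le> q"
    and b: "\<And>i. i \<in> {1..q-1} \<Longrightarrow> \<P>(\<omega> in M. E 1 \<omega> = i) = (1 - \<P>(\<omega> in M. E 1 \<omega> = 0)) * b i"
  shows "\<P>(\<omega> in M. partial_sum E m \<omega> < q) =
    (\<Sum>k=0..q-1. binom_term m k (\<P>(\<omega> in M. E 1 \<omega> = 0)) * gamma_coeff b q k)"
proof -
  let ?a = "\<P>(\<omega> in M. E 1 \<omega> = 0)"
  define W where "W = [:?a:] + smult (1 - ?a) (\<Sum>i=1..q-1. monom (b i) i)"
  have W: "coeff W i = \<P>(\<omega> in M. E 1 \<omega> = i)" if "i < q" for i
    using that b[of i] by (cases "i = 0") (auto simp: W_def coeff_sum coeff_pCons split: nat.splits)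
  have "\<P>(\<omega> in M. partial_sum E m \<omega> < q) = prob (\<Union>s\<in>{..<q}. {\<omega>\<in>space M. partial_sum E m \<omega> = s})"
    by (intro arg_cong[where f = prob]) auto
  also have "\<dots> = (\<Sum>s<q. \<P>(\<omega> in M. partial_sum E m \<omega> = s))"
    by (intro finite_measure_finite_Union) (auto simp: disjoint_family_on_def)
  also have "\<dots> = (\<Sum>s<q. coeff (W ^ m) s)"
    using W by (intro sum.cong refl prob_partial_sum_eq_coeff) auto
  also have "\<dots> = (\<Sum>k=0..q-1. binom_term m k ?a * gamma_coeff b q k)"
    unfolding W_def binom_term_def by (rule sum_coeff_power_eq_gamma[OF assms(1)])
  finally show ?thesis .
qed

end

section \<open>Exceedances counted cycle by cycle\<close>

text \<open>The truncation at \<open>r\<close> makes the count a function of the first \<open>r\<close> cycle maxima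
  (\<open>exceed_eq_sum_cycle_max_vec\<close>), so it inherits independence and identical distribution from
  their vectors.\<close>

definition exceed :: "(nat \<Rightarrow> 'a \<Rightarrow> real) \<Rightarrow> (nat \<Rightarrow> 'a \<Rightarrow> nat) \<Rightarrow> nat \<Rightarrow> real \<Rightarrow> nat \<Rightarrow> 'a \<Rightarrow> nat" where
  "exceed X S r x j \<omega> = min r (card {k\<in>{cycle_start S j \<omega>..<S j \<omega>}. x < X k \<omega>})"

lemma less_cycle_max_iff:
  assumes "1 \<le> i" "i \<le> r"
  shows "ereal x < cycle_max X S i j \<omega> \<longleftrightarrow> i \<le> exceed X S r x j \<omega>"
proof -
  have "cycle_max X S i j \<omega> \<le> ereal x \<longleftrightarrow> card {k\<in>{cycle_start S j \<omega>..<S j \<omega>}. x < X k \<omega>} < i"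
    unfolding cycle_max_def using assms by (intro kth_largest_le_iff) auto
  then show ?thesis using assms by (auto simp: exceed_def not_le[symmetric])
qed

lemma exceed_eq_sum_cycle_max_vec:
  "exceed X S r x j \<omega> = (\<Sum>i\<in>{1..r}. of_bool (ereal x < cycle_max_vec X S r j \<omega> i))"
proof -
  have "(\<Sum>i\<in>{1..r}. of_bool (ereal x < cycle_max_vec X S r j \<omega> i)) =
      (\<Sum>i\<in>{1..r}. of_bool (i \<le> exceed X S r x j \<omega>) :: nat)"
    by (intro sum.cong) (auto simp: cycle_max_vec_def less_cycle_max_iff[where r = r])
  also have "\<dots> = card ({1..r} \<inter> {i. i \<le> exceed X S r x j \<omega>})"
    by (simp add: sum_of_bool_eq)
  also have "{1..r} \<inter> {i. i \<le> exceed X S r x j \<omega>} = {1..exceed X S r x j \<omega>}"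
    by (auto simp: exceed_def)
  finally show ?thesis by simp
qed

text \<open>Truncation at \<open>r \<ge> q\<close> is harmless, because a term that is really cut reaches \<open>q\<close>
  by itself.\<close>

lemma le_sum_min:
  fixes c :: "'i \<Rightarrow> nat"
  assumes "finite A" "q \<le> r" "q \<le> (\<Sum>j\<in>A. c j)"
  shows "q \<le> (\<Sum>j\<in>A. min r (c j))"
proof (cases "\<exists>j\<in>A. r \<le> c j")
  case True
  then obtain j where j: "j \<in> A" "r \<le> c j" by blast
  then have "min r (c j) \<le> (\<Sum>j\<in>A. min r (c j))"
    using assms(1) by (intro member_le_sum) auto
  then show ?thesis using j assms(2) by simp
next
  case False
  then have "(\<Sum>j\<in>A. min r (c j)) = (\<Sum>j\<in>A. c j)" by (intro sum.cong) auto
  then show ?thesis using assms(3) by simp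
qed

lemma sum_cycle_counts:
  assumes S: "\<And>n. S n \<omega> < S (Suc n) \<omega>"
  shows "(\<Sum>j=1..m. card {k\<in>{cycle_start S j \<omega>..<S j \<omega>}. P k}) = card {k\<in>{S 0 \<omega>..<S m \<omega>}. P k}"
proof (induction m)
  case (Suc m)
  have "S 0 \<omega> \<le> S m \<omega>" using lift_Suc_mono_le[of "\<lambda>n. S n \<omega>" 0 m] S less_imp_le by blast
  then have "{k\<in>{S 0 \<omega>..<S (Suc m) \<omega>}. P k} =
      {k\<in>{S 0 \<omega>..<S m \<omega>}. P k} \<union> {k\<in>{cycle_start S (Suc m) \<omega>..<S (Suc m) \<omega>}. P k}"
    using S[of m] by (auto simp: cycle_start_def)
  moreover have "card ({k\<in>{S 0 \<omega>..<S m \<omega>}. P k} \<union> {k\<in>{cycle_start S (Suc m) \<omega>..<S (Suc m) \<omega>}. P k}) =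
      card {k\<in>{S 0 \<omega>..<S m \<omega>}. P k} + card {k\<in>{cycle_start S (Suc m) \<omega>..<S (Suc m) \<omega>}. P k}"
    by (intro card_Un_disjoint) (auto simp: cycle_start_def)
  ultimately show ?case using Suc.IH by simp
qed simp

text \<open>The cycles \<open>1, \<dots>, m\<close> occupy the times from \<open>S 0 \<ge> 1\<close> to \<open>S m - 1
  \<le> n\<close>.\<close>

lemma sum_exceed_le_count:
  assumes "\<And>n. S n \<omega> < S (Suc n) \<omega>" "0 < S 0 \<omega>" "S m \<omega> \<le> n + 1"
  shows "partial_sum (exceed X S r x) m \<omega> \<le> card {k\<in>{1..n}. x < X k \<omega>}"
proof -
  have "partial_sum (exceed X S r x) m \<omega> \<le>
      (\<Sum>j=1..m. card {k\<in>{cycle_start S j \<omega>..<S j \<omega>}. x < X k \<omega>})"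
    unfolding partial_sum_def by (intro sum_mono) (simp add: exceed_def)
  also have "\<dots> = card {k\<in>{S 0 \<omega>..<S m \<omega>}. x < X k \<omega>}"
    by (rule sum_cycle_counts[where S = S and \<omega> = \<omega>, OF assms(1)])
  also have "\<dots> \<le> card {k\<in>{1..n}. x < X k \<omega>}"
    using assms(2,3) by (intro card_mono) auto
  finally show ?thesis .
qed

text \<open>The cycles \<open>0, \<dots>, m\<close> cover all times up to \<open>S m - 1 \<ge> n\<close>.\<close>

lemma le_sum_exceed:
  assumes "\<And>n. S n \<omega> < S (Suc n) \<omega>" "n < S m \<omega>" "q \<le> r" "q \<le> card {k\<in>{1..n}. x < X k \<omega>}"
  shows "q \<le> exceed X S r x 0 \<omega> + partial_sum (exceed X S r x) m \<omega>"
proof -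
  let ?c = "\<lambda>j. card {k\<in>{cycle_start S j \<omega>..<S j \<omega>}. x < X k \<omega>}"
  have "q \<le> card {k\<in>{1..n}. x < X k \<omega>}" by fact
  also have "\<dots> \<le> card ({k\<in>{cycle_start S 0 \<omega>..<S 0 \<omega>}. x < X k \<omega>} \<union> {k\<in>{S 0 \<omega>..<S m \<omega>}. x < X k \<omega>})"
    using assms(2) by (intro card_mono) (auto simp: cycle_start_def)
  also have "\<dots> \<le> ?c 0 + card {k\<in>{S 0 \<omega>..<S m \<omega>}. x < X k \<omega>}"
    by (rule card_Un_le)
  also have "\<dots> = ?c 0 + (\<Sum>j=1..m. ?c j)"
    by (simp only: sum_cycle_counts[where S = S and \<omega> = \<omega>, OF assms(1)])
  also have "\<dots> = (\<Sum>j\<in>insert 0 {1..m}. ?c j)" by simp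
  finally have "q \<le> (\<Sum>j\<in>insert 0 {1..m}. min r (?c j))"
    using assms(3) by (intro le_sum_min) auto
  then show ?thesis by (simp add: exceed_def partial_sum_def)
qed

lemma regeneration_time_eq:
  assumes "\<And>n. S n \<omega> < S (Suc n) \<omega>"
  shows "S m \<omega> = S 0 \<omega> + (\<Sum>j=1..m. cycle_length S j \<omega>)"
proof (induction m)
  case (Suc m)
  then show ?case using assms[of m] by (simp add: cycle_length_def cycle_start_def)
qed simp

locale max_regenerative_process = prob_space +
  fixes r :: nat and X :: "nat \<Rightarrow> 'a \<Rightarrow> real" and S :: "nat \<Rightarrow> 'a \<Rightarrow> nat"
  assumes r: "1 \<le> r"
    and measurable_X[measurable]: "\<And>n. X n \<in> borel_measurable M"
    and regenerative: "max_regenerative M r X S"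
    and integrable_cycle_length: "integrable M (\<lambda>\<omega>. real (cycle_length S 1 \<omega>))"
    and first_cycle_negligible:
      "(\<lambda>n. \<P>(\<omega> in M. (MAX k\<in>{1..n}. cycle_max X S 1 k \<omega>) < cycle_max X S 1 0 \<omega>)) \<longlonglongrightarrow> 0"
begin

lemma measurable_S[measurable]: "S n \<in> measurable M (count_space UNIV)"
  using regenerative by (auto simp: max_regenerative_def)

lemma S_0_pos: "\<omega> \<in> space M \<Longrightarrow> 0 < S 0 \<omega>"
  and S_less: "\<omega> \<in> space M \<Longrightarrow> S n \<omega> < S (Suc n) \<omega>"
  using regenerative by (auto simp: max_regenerative_def)

lemma indep_cycle_length: "indep_vars (\<lambda>_. count_space UNIV) (cycle_length S) UNIV"
  and indep_cycle_max_vec: "indep_vars (\<lambda>_. Pi\<^sub>M {1..r} (\<lambda>_. borel)) (cycle_max_vec X S r) UNIV"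
  using regenerative by (auto simp: max_regenerative_def)

lemma distr_cycle_length:
  "1 \<le> n \<Longrightarrow> distr M (count_space UNIV) (cycle_length S n) = distr M (count_space UNIV) (cycle_length S 1)"
  using regenerative unfolding max_regenerative_def by blast

lemma distr_cycle_max_vec:
  "1 \<le> n \<Longrightarrow> distr M (Pi\<^sub>M {1..r} (\<lambda>_. borel)) (cycle_max_vec X S r n) =
    distr M (Pi\<^sub>M {1..r} (\<lambda>_. borel)) (cycle_max_vec X S r 1)"
  using regenerative unfolding max_regenerative_def by blast

lemma measurable_cycle_length[measurable]: "cycle_length S n \<in> measurable M (count_space UNIV)"
  using indep_cycle_length by (auto simp: indep_vars_def)

lemma measurable_cycle_max_vec[measurable]:
  "cycle_max_vec X S r n \<in> measurable M (Pi\<^sub>M {1..r} (\<lambda>_. borel))"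
  using indep_cycle_max_vec by (auto simp: indep_vars_def)

lemma measurable_cycle_max[measurable]:
  assumes "i \<in> {1..r}"
  shows "cycle_max X S i n \<in> borel_measurable M"
proof -
  have "(\<lambda>\<omega>. cycle_max_vec X S r n \<omega> i) \<in> borel_measurable M"
    using assms by measurable
  then show ?thesis using assms by (simp add: cycle_max_vec_def)
qed

sublocale count: iid_counts M "exceed X S r x" for x
proof
  define g where "g v = (\<Sum>i\<in>{1..r}. of_bool (ereal x < v i) :: nat)" for v :: "nat \<Rightarrow> ereal"
  have g[measurable]: "g \<in> measurable (Pi\<^sub>M {1..r} (\<lambda>_. borel)) (count_space UNIV)"
    unfolding g_def[abs_def] of_bool_def by measurable
  have eq: "exceed X S r x = (\<lambda>j \<omega>. g (cycle_max_vec X S r j \<omega>))"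
    by (intro ext) (simp add: g_def exceed_eq_sum_cycle_max_vec)
  show "indep_vars (\<lambda>_. count_space UNIV) (exceed X S r x) UNIV"
    unfolding eq by (rule indep_vars_compose2[OF indep_cycle_max_vec]) (rule g)
  fix j i :: nat assume "1 \<le> j"
  let ?N = "Pi\<^sub>M {1..r} (\<lambda>_. borel) :: (nat \<Rightarrow> ereal) measure"
  have *: "\<P>(\<omega> in M. exceed X S r x j \<omega> = i) =
      measure (distr M ?N (cycle_max_vec X S r j)) (g -` {i} \<inter> space ?N)" for j
  proof -
    have "measure (distr M ?N (cycle_max_vec X S r j)) (g -` {i} \<inter> space ?N) =
        prob (cycle_max_vec X S r j -` (g -` {i} \<inter> space ?N) \<inter> space M)"
      by (rule measure_distr[OF measurable_cycle_max_vec measurable_sets[OF g]]) simp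
    also have "cycle_max_vec X S r j -` (g -` {i} \<inter> space ?N) \<inter> space M = {\<omega>\<in>space M. exceed X S r x j \<omega> = i}"
      using measurable_space[OF measurable_cycle_max_vec] by (auto simp: eq)
    finally show ?thesis by simp
  qed
  show "\<P>(\<omega> in M. exceed X S r x j \<omega> = i) = \<P>(\<omega> in M. exceed X S r x 1 \<omega> = i)"
    unfolding *[of j] *[of 1] distr_cycle_max_vec[OF \<open>1 \<le> j\<close>] ..
qed

end

section \<open>The distribution of the cycle maxima\<close>

context max_regenerative_process
begin

lemma measurable_first_cycle_max[measurable]:
  "cycle_max X S 1 n \<in> borel_measurable M" "cycle_max X S (Suc 0) n \<in> borel_measurable M"
  using measurable_cycle_max[of 1 n] r by auto

lemma exceed_neq_0_iff: "exceed X S r x j \<omega> \<noteq> 0 \<longleftrightarrow> ereal x < cycle_max X S 1 j \<omega>"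
  using less_cycle_max_iff[of 1 r x X S j \<omega>] r by auto

lemma exceed_eq_iff:
  assumes "1 \<le> i" "i < r"
  shows "exceed X S r x j \<omega> = i \<longleftrightarrow>
    cycle_max X S (i + 1) j \<omega> \<le> ereal x \<and> ereal x < cycle_max X S i j \<omega>"
  using less_cycle_max_iff[of i r x X S j \<omega>] less_cycle_max_iff[of "i + 1" r x X S j \<omega>] assms
  by (auto simp: not_less[symmetric])

definition cycle_cdf :: "real \<Rightarrow> real" where
  "cycle_cdf x = \<P>(\<omega> in M. cycle_max X S 1 1 \<omega> \<le> ereal x)"

lemma cycle_cdf_eq_exceed: "cycle_cdf x = \<P>(\<omega> in M. exceed X S r x 1 \<omega> = 0)"
  unfolding cycle_cdf_def using exceed_neq_0_iff[of x 1] by (metis not_less)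

lemma cycle_cdf_bounds: "0 \<le> cycle_cdf x" "cycle_cdf x \<le> 1"
  by (auto simp: cycle_cdf_def)

lemma cycle_cdf_mono:
  assumes "x \<le> y" shows "cycle_cdf x \<le> cycle_cdf y"
proof -
  show ?thesis
    unfolding cycle_cdf_def using assms by (intro finite_measure_mono) (auto intro: order_trans)
qed

text \<open>By right-continuity of the distribution function. Consequently every level with \<open>cycle_cdf x < 1\<close>
  lies strictly below the right endpoint, as an approach from below requires.\<close>

lemma cycle_cdf_less_1_right:
  assumes "cycle_cdf x < 1"
  shows "\<exists>y>x. cycle_cdf y < 1"
proof -
  define A where "A n = {\<omega>\<in>space M. cycle_max X S 1 1 \<omega> \<le> ereal (x + 1 / Suc n)}" for n
  have "(\<lambda>n. prob (A n)) \<longlonglongrightarrow> prob (\<Inter>n. A n)"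
  proof (rule finite_Lim_measure_decseq)
    show "decseq A"
    proof (rule decseq_SucI)
      fix n
      have "1 / real (Suc (Suc n)) \<le> 1 / real (Suc n)" by (simp add: frac_le)
      then show "A (Suc n) \<subseteq> A n"
        unfolding A_def by (auto elim!: order_trans)
    qed
  qed (auto simp: A_def)
  also have "(\<Inter>n. A n) = {\<omega>\<in>space M. cycle_max X S 1 1 \<omega> \<le> ereal x}"
  proof safe
    fix \<omega> assume \<omega>: "\<omega> \<in> (\<Inter>n. A n)"
    then show "\<omega> \<in> space M" by (auto simp: A_def)
    have "(\<lambda>n. ereal (x + 1 / Suc n)) \<longlonglongrightarrow> ereal (x + 0)"
      by (intro tendsto_intros LIMSEQ_Suc[OF lim_1_over_n])
    then show "cycle_max X S 1 1 \<omega> \<le> ereal x"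
      using \<omega> by (intro LIMSEQ_le_const[where X = "\<lambda>n. ereal (x + 1 / Suc n)"]) (auto simp: A_def)
  next
    fix \<omega> n assume "\<omega> \<in> space M" "cycle_max X S 1 1 \<omega> \<le> ereal x"
    moreover have "ereal x \<le> ereal (x + 1 / Suc n)" by simp
    ultimately show "\<omega> \<in> A n" unfolding A_def by (blast intro: order_trans)
  qed
  finally have "(\<lambda>n. prob (A n)) \<longlonglongrightarrow> cycle_cdf x" by (simp add: cycle_cdf_def)
  then have "\<forall>\<^sub>F n in sequentially. prob (A n) < 1"
    using assms by (rule order_tendstoD(2))
  then obtain n where "prob (A n) < 1" by (auto dest: eventually_happens)
  then have "x < x + 1 / Suc n" "cycle_cdf (x + 1 / Suc n) < 1"
    by (auto simp: A_def cycle_cdf_def)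
  then show ?thesis by blast
qed

lemma mean_cycle_ge_1: "1 \<le> mean_cycle M S"
proof -
  have "1 \<le> cycle_length S 1 \<omega>" if "\<omega> \<in> space M" for \<omega>
    using S_less[OF that, of 0] by (simp add: cycle_length_def cycle_start_def)
  then have "expectation (\<lambda>_. 1) \<le> mean_cycle M S"
    unfolding mean_cycle_def using integrable_cycle_length
    by (intro integral_mono) (auto simp flip: One_nat_def)
  then show ?thesis by (simp add: prob_space)
qed

lemma cycle_df_eq: "cycle_df M X S x = cycle_cdf x powr (1 / mean_cycle M S)"
  by (simp add: cycle_df_def cycle_cdf_def)

lemma cycle_df_less_1_iff: "cycle_df M X S x < 1 \<longleftrightarrow> cycle_cdf x < 1"
proof (cases "cycle_cdf x = 1")
  case True
  then show ?thesis by (simp add: cycle_df_eq)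
next
  case False
  then have "cycle_cdf x < 1" using cycle_cdf_bounds[of x] by simp
  moreover have "cycle_cdf x powr (1 / mean_cycle M S) < 1 powr (1 / mean_cycle M S)"
    using cycle_cdf_bounds[of x] mean_cycle_ge_1 \<open>cycle_cdf x < 1\<close> by (intro powr_less_mono2) auto
  ultimately show ?thesis by (simp add: cycle_df_eq)
qed

text \<open>A uniform treatment of finite and infinite right endpoints: it restates closeness to the endpoint as a lower
  bound \<open>x0\<close> on the level, with \<open>x0\<close> itself still below the endpoint.\<close>

lemma eventually_real_at_left_right_endpointD:
  assumes P: "eventually P (real_at_left (right_endpoint (cycle_df M X S)))"
    and ex: "\<exists>x. cycle_cdf x < 1"
  shows "\<exists>x0. cycle_cdf x0 < 1 \<and> (\<forall>x>x0. cycle_cdf x < 1 \<longrightarrow> P x)"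
proof -
  let ?c = "right_endpoint (cycle_df M X S)"
  have c: "?c = (SUP x\<in>{x. cycle_cdf x < 1}. ereal x)"
    by (simp add: right_endpoint_def cycle_df_less_1_iff)
  have less: "ereal x < ?c" if "cycle_cdf x < 1" for x
  proof -
    obtain y where "x < y" "cycle_cdf y < 1" using cycle_cdf_less_1_right \<open>cycle_cdf x < 1\<close> by blast
    then have "ereal x < ereal y" "ereal y \<le> ?c" unfolding c by (auto intro: SUP_upper)
    then show ?thesis by (rule less_le_trans)
  qed
  obtain Q where Q: "eventually Q (at_left ?c)" "\<And>x. Q (ereal x) \<Longrightarrow> P x"
    using P by (auto simp: real_at_left_def eventually_filtercomap)
  obtain x1 where "cycle_cdf x1 < 1" using ex by blast
  then obtain b where b: "b < ?c" "\<And>y. b < y \<Longrightarrow> y < ?c \<Longrightarrow> Q y"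
    using Q(1) less[of x1] by (subst (asm) eventually_at_left[of "ereal x1"]) auto
  obtain x0 where "cycle_cdf x0 < 1" "b < ereal x0"
    using b(1) unfolding c less_SUP_iff by auto
  moreover have "P x" if "x0 < x" "cycle_cdf x < 1" for x
    using \<open>b < ereal x0\<close> that less[of x] by (intro Q(2) b(2)) (auto intro: less_trans)
  ultimately show ?thesis by blast
qed

lemma cluster_prob_bounds: "0 \<le> cluster_prob M X S i x" "cluster_prob M X S i x \<le> 1"
  unfolding cluster_prob_def cond_prob_def
proof -
  show "0 \<le> \<P>(\<omega> in M. (cycle_max X S (i + 1) 1 \<omega> \<le> ereal x \<and> ereal x < cycle_max X S i 1 \<omega>)
    \<and> ereal x < cycle_max X S 1 1 \<omega>) / \<P>(\<omega> in M. ereal x < cycle_max X S 1 1 \<omega>)"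
    by simp
  have "\<P>(\<omega> in M. (cycle_max X S (i + 1) 1 \<omega> \<le> ereal x \<and> ereal x < cycle_max X S i 1 \<omega>)
    \<and> ereal x < cycle_max X S 1 1 \<omega>) \<le> \<P>(\<omega> in M. ereal x < cycle_max X S 1 1 \<omega>)"
    by (intro finite_measure_mono) auto
  then show "\<P>(\<omega> in M. (cycle_max X S (i + 1) 1 \<omega> \<le> ereal x \<and> ereal x < cycle_max X S i 1 \<omega>)
    \<and> ereal x < cycle_max X S 1 1 \<omega>) / \<P>(\<omega> in M. ereal x < cycle_max X S 1 1 \<omega>) \<le> 1"
    by (intro divide_le_eq_1[THEN iffD2]) (auto simp: less_le)
qed

lemma prob_exceed_neq_0: "1 \<le> j \<Longrightarrow> \<P>(\<omega> in M. exceed X S r x j \<omega> \<noteq> 0) = 1 - cycle_cdf x"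
  unfolding cycle_cdf_eq_exceed
  using count.ident[of j x 0] by (subst prob_neg) auto

lemma prob_exceed_eq_cluster_prob:
  assumes "1 \<le> i" "i < r"
  shows "\<P>(\<omega> in M. exceed X S r x 1 \<omega> = i) = (1 - cycle_cdf x) * cluster_prob M X S i x"
proof -
  have "\<P>(\<omega> in M. exceed X S r x 1 \<omega> = i) \<le> \<P>(\<omega> in M. exceed X S r x 1 \<omega> \<noteq> 0)"
    using assms by (intro finite_measure_mono) auto
  \<comment> \<open>If \<open>cycle_cdf x = 1\<close>, the conditional probability is a quotient by \<open>0\<close>.\<close>
  then have zero: "\<P>(\<omega> in M. exceed X S r x 1 \<omega> = i) = 0" if "1 - cycle_cdf x = 0"
    using that prob_exceed_neq_0[of 1 x] by (simp add: measure_le_0_iff)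
  have "\<P>(\<omega> in M. exceed X S r x 1 \<omega> = i \<and> exceed X S r x 1 \<omega> \<noteq> 0) = \<P>(\<omega> in M. exceed X S r x 1 \<omega> = i)"
    using assms by (intro arg_cong[where f = prob]) auto
  then have "cluster_prob M X S i x = \<P>(\<omega> in M. exceed X S r x 1 \<omega> = i) / (1 - cycle_cdf x)"
    unfolding cluster_prob_def cond_prob_def exceed_eq_iff[OF assms, symmetric]
      exceed_neq_0_iff[symmetric] prob_exceed_neq_0[OF order_refl] by simp
  then show ?thesis using zero by auto
qed

lemma prob_partial_sum_less:
  assumes "q \<in> {2..r}"
  shows "\<P>(\<omega> in M. partial_sum (exceed X S r x) m \<omega> < q) =
    (\<Sum>k=0..q-1. binom_term m k (cycle_cdf x) * gamma_coeff (\<lambda>i. cluster_prob M X S i x) q k)"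
  unfolding cycle_cdf_eq_exceed
  by (intro count.prob_partial_sum_less_eq prob_exceed_eq_cluster_prob[unfolded cycle_cdf_eq_exceed])
    (use assms in auto)

end

section \<open>Replacing time by the expected number of cycles\<close>

text \<open>The bound of \<open>prob_partial_sum_crosses_le\<close> for \<open>(1 - \<epsilon>) * t\<close> and \<open>(1
  + \<epsilon>) * t\<close> cycles. Roughly, \<open>h - l\<close> is of order \<open>\<epsilon> * t\<close> and
  \<open>l div q\<close> of order \<open>t / q\<close>.\<close>

lemma nat_ceiling_floor_gap_le:
  fixes t \<epsilon> :: real
  assumes "0 < \<epsilon>" "\<epsilon> \<le> 1 / 2" "4 \<le> t" "1 \<le> \<epsilon> * t" "1 \<le> q"
  defines "l \<equiv> nat \<lfloor>(1 - \<epsilon>) * t\<rfloor>" and "h \<equiv> nat \<lceil>(1 + \<epsilon>) * t\<rceil>"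
  shows "real q * real (h - l) / (l div q + 1) \<le> 16 * (real q)\<^sup>2 * \<epsilon>"
proof -
  have "1 / 2 * t \<le> (1 - \<epsilon>) * t" using assms by (intro mult_right_mono) auto
  then have l: "(1 - \<epsilon>) * t - 1 \<le> real l" "t / 4 \<le> real l"
    using assms(3) unfolding l_def by linarith+
  have h: "real h \<le> (1 + \<epsilon>) * t + 1"
  proof -
    have "0 \<le> (1 + \<epsilon>) * t" using assms by auto
    then show ?thesis unfolding h_def by linarith
  qed
  have "(1 + \<epsilon>) * t - (1 - \<epsilon>) * t = 2 * (\<epsilon> * t)" by (simp add: algebra_simps)
  then have "real (h - l) \<le> 4 * (\<epsilon> * t)" using l h assms(4) by linarith
  have "real l = real (l div q) * q + real (l mod q)"
    by (metis div_mult_mod_eq of_nat_add of_nat_mult)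
  also have "\<dots> \<le> real (l div q) * q + q" using assms(5) by (intro add_left_mono) (simp add: less_imp_le)
  finally have "t / 4 \<le> (real (l div q) + 1) * q" using l(2) by (simp add: algebra_simps)
  then have "real q * real (h - l) * t \<le> real q * (4 * (\<epsilon> * t)) * (4 * ((real (l div q) + 1) * q))"
    using \<open>real (h - l) \<le> _\<close> assms by (intro mult_mono) auto
  then have "real q * real (h - l) \<le> 16 * (real q)\<^sup>2 * \<epsilon> * (real (l div q) + 1)"
  proof -
    have "t * (real q * real (h - l)) \<le> t * (16 * (real q)\<^sup>2 * \<epsilon> * (real (l div q) + 1))"
      using \<open>real q * real (h - l) * t \<le> _\<close> by (simp add: power2_eq_square algebra_simps)
    then show ?thesis using assms(3) by (subst (asm) mult_le_cancel_left_pos) auto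
  qed
  then show ?thesis by (simp add: field_simps)
qed

context max_regenerative_process
begin

lemma order_max_le_iff:
  "1 \<le> q \<Longrightarrow> order_max X q n \<omega> \<le> ereal x \<longleftrightarrow> card {k\<in>{1..n}. x < X k \<omega>} < q"
  unfolding order_max_def by (rule kth_largest_le_iff) auto

lemma measurable_count[measurable]:
  "(\<lambda>\<omega>. card {k\<in>{1..n}. x < X k \<omega>}) \<in> measurable M (count_space UNIV)"
proof -
  have "(\<lambda>\<omega>. card {k\<in>{1..n}. x < X k \<omega>}) = (\<lambda>\<omega>. \<Sum>k\<in>{1..n}. of_bool (x < X k \<omega>))"
    by (simp add: sum_of_bool_eq Int_def)
  also have "\<dots> \<in> measurable M (count_space UNIV)"
    unfolding of_bool_def by measurable
  finally show ?thesis .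
qed

text \<open>The number of cycles up to time \<open>n\<close> may depend on the cycle maxima, so it is enclosed between
  fixed numbers \<open>l\<close> and \<open>h\<close>. The errors are, in this order: too few cycles are
  finished at time \<open>n\<close>, too many are, the count passes \<open>q\<close> between \<open>l\<close>
  and \<open>h\<close>, and the initial cycle contributes.\<close>

lemma prob_order_max_approx:
  assumes q: "1 \<le> q" "q \<le> r" and m: "l \<le> m" "m \<le> h"
  shows "\<bar>\<P>(\<omega> in M. order_max X q n \<omega> \<le> ereal x) - \<P>(\<omega> in M. partial_sum (exceed X S r x) m \<omega> < q)\<bar> \<le>
     \<P>(\<omega> in M. n + 1 < S l \<omega>) + \<P>(\<omega> in M. S h \<omega> \<le> n)
     + \<P>(\<omega> in M. partial_sum (exceed X S r x) l \<omega> < q \<and> q \<le> partial_sum (exceed X S r x) h \<omega>)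
     + \<P>(\<omega> in M. partial_sum (exceed X S r x) h \<omega> < q \<and> exceed X S r x 0 \<omega> \<noteq> 0)"
proof -
  let ?T = "partial_sum (exceed X S r x)" and ?N = "\<lambda>\<omega>. card {k\<in>{1..n}. x < X k \<omega>}"
  define A B where "A = {\<omega>\<in>space M. ?N \<omega> < q}" and "B = {\<omega>\<in>space M. ?T m \<omega> < q}"
  define D where "D = {\<omega>\<in>space M. n + 1 < S l \<omega>} \<union> {\<omega>\<in>space M. S h \<omega> \<le> n}
    \<union> {\<omega>\<in>space M. ?T l \<omega> < q \<and> q \<le> ?T h \<omega>} \<union> {\<omega>\<in>space M. ?T h \<omega> < q \<and> exceed X S r x 0 \<omega> \<noteq> 0}"
  have [measurable]: "A \<in> sets M" "B \<in> sets M" "D \<in> sets M" unfolding A_def B_def D_def by measurable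
  have mono: "?T l \<omega> \<le> ?T m \<omega>" "?T m \<omega> \<le> ?T h \<omega>" for \<omega>
    using m by (auto simp: partial_sum_def intro!: sum_mono2)
  have "A \<subseteq> B \<union> D"
  proof
    fix \<omega> assume "\<omega> \<in> A"
    then have \<omega>: "\<omega> \<in> space M" "?N \<omega> < q" by (auto simp: A_def)
    have "?T l \<omega> < q" if "\<not> n + 1 < S l \<omega>"
      using sum_exceed_le_count[where S = S and \<omega> = \<omega> and m = l and n = n and X = X and r = r and x = x]
        S_less S_0_pos \<omega> that by (auto simp: not_less intro: le_less_trans)
    then show "\<omega> \<in> B \<union> D" using mono[of \<omega>] \<omega>(1) by (auto simp: B_def D_def)
  qed
  moreover have "B \<subseteq> A \<union> D"
  proof
    fix \<omega> assume "\<omega> \<in> B"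
    then have \<omega>: "\<omega> \<in> space M" "?T m \<omega> < q" by (auto simp: B_def)
    have "q \<le> exceed X S r x 0 \<omega> + ?T h \<omega>" if "\<not> S h \<omega> \<le> n" "q \<le> ?N \<omega>"
      using le_sum_exceed[where S = S and \<omega> = \<omega> and m = h and n = n and X = X and r = r and x = x and q = q]
        S_less \<omega> that q by auto
    then show "\<omega> \<in> A \<union> D" using mono[of \<omega>] \<omega> by (force simp: A_def D_def)
  qed
  ultimately have "prob A \<le> prob B + prob D" "prob B \<le> prob A + prob D"
    using finite_measure_mono[of A "B \<union> D"] finite_measure_mono[of B "A \<union> D"]
      measure_Un_le[of B M D] measure_Un_le[of A M D] by auto
  moreover have "prob D \<le> \<P>(\<omega> in M. n + 1 < S l \<omega>) + \<P>(\<omega> in M. S h \<omega> \<le> n)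
     + \<P>(\<omega> in M. ?T l \<omega> < q \<and> q \<le> ?T h \<omega>) + \<P>(\<omega> in M. ?T h \<omega> < q \<and> exceed X S r x 0 \<omega> \<noteq> 0)"
    unfolding D_def by (intro order_trans[OF measure_Un_le] add_mono order_refl) auto
  ultimately show ?thesis
    unfolding order_max_le_iff[OF q(1)] A_def[symmetric] B_def[symmetric] by linarith
qed

text \<open>Some block of \<open>m div q\<close> cycles stays below \<open>x\<close> while the initial cycle does not. All
  blocks being equivalent in law, this may be taken to be the first one, and then the maximum of the initial
  cycle beats all maxima of that block; \<open>x\<close> drops out.\<close>

lemma prob_first_cycle_exceeds_le:
  assumes "0 < m div q"
  shows "\<P>(\<omega> in M. partial_sum (exceed X S r x) m \<omega> < q \<and> exceed X S r x 0 \<omega> \<noteq> 0) \<le>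
    real q * \<P>(\<omega> in M. (MAX k\<in>{1..m div q}. cycle_max X S 1 k \<omega>) < cycle_max X S 1 0 \<omega>)"
proof -
  let ?L = "m div q"
  have "cycle_cdf x ^ ?L * \<P>(\<omega> in M. exceed X S r x 0 \<omega> \<noteq> 0) =
      \<P>(\<omega> in M. (\<forall>j\<in>{..<?L}. exceed X S r x (Suc j) \<omega> = 0) \<and> exceed X S r x 0 \<omega> \<noteq> 0)"
    using count.prob_block_free[of "{..<?L}" 0 x] by (simp add: cycle_cdf_eq_exceed)
  also have "\<dots> \<le> \<P>(\<omega> in M. (MAX k\<in>{1..?L}. cycle_max X S 1 k \<omega>) < cycle_max X S 1 0 \<omega>)"
  proof (rule finite_measure_mono)
    have "(MAX k\<in>{1..?L}. cycle_max X S 1 k \<omega>) < cycle_max X S 1 0 \<omega>"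
      if z: "\<forall>j\<in>{..<?L}. exceed X S r x (Suc j) \<omega> = 0" and nz: "exceed X S r x 0 \<omega> \<noteq> 0" for \<omega>
    proof -
      have "cycle_max X S 1 k \<omega> \<le> ereal x" if "k \<in> {1..?L}" for k
        using z that exceed_neq_0_iff[of x k \<omega>] by (cases k) (auto simp: not_less)
      then have "(MAX k\<in>{1..?L}. cycle_max X S 1 k \<omega>) \<le> ereal x"
        using assms by (subst Max_le_iff) auto
      also have "\<dots> < cycle_max X S 1 0 \<omega>" using nz exceed_neq_0_iff by blast
      finally show ?thesis .
    qed
    then show "{\<omega>\<in>space M. (\<forall>j\<in>{..<?L}. exceed X S r x (Suc j) \<omega> = 0) \<and> exceed X S r x 0 \<omega> \<noteq> 0} \<subseteq>
        {\<omega>\<in>space M. (MAX k\<in>{1..?L}. cycle_max X S 1 k \<omega>) < cycle_max X S 1 0 \<omega>}"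
      by blast
  next
    have "(\<lambda>\<omega>. MAX k\<in>{1..?L}. cycle_max X S 1 k \<omega>) \<in> borel_measurable M"
      using assms by (intro borel_measurable_Max) auto
    then show "{\<omega>\<in>space M. (MAX k\<in>{1..?L}. cycle_max X S 1 k \<omega>) < cycle_max X S 1 0 \<omega>} \<in> events"
      by measurable
  qed
  finally have *: "cycle_cdf x ^ ?L * \<P>(\<omega> in M. exceed X S r x 0 \<omega> \<noteq> 0) \<le>
    \<P>(\<omega> in M. (MAX k\<in>{1..?L}. cycle_max X S 1 k \<omega>) < cycle_max X S 1 0 \<omega>)" .
  have "\<P>(\<omega> in M. partial_sum (exceed X S r x) m \<omega> < q \<and> exceed X S r x 0 \<omega> \<noteq> 0) \<le>
      q * (cycle_cdf x ^ ?L * \<P>(\<omega> in M. exceed X S r x 0 \<omega> \<noteq> 0))"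
    using count.prob_partial_sum_less_and_exceed_le[of 0 m x q] by (simp add: cycle_cdf_eq_exceed)
  also have "\<dots> \<le> q * \<P>(\<omega> in M. (MAX k\<in>{1..?L}. cycle_max X S 1 k \<omega>) < cycle_max X S 1 0 \<omega>)"
    using * by (intro mult_left_mono) auto
  finally show ?thesis .
qed

lemma cycle_lengths_weak_law:
  fixes \<epsilon> :: real
  assumes "0 < \<epsilon>"
  shows "(\<lambda>m. \<P>(\<omega> in M. \<epsilon> * m \<le> \<bar>(\<Sum>j=1..m. real (cycle_length S j \<omega>)) - m * mean_cycle M S\<bar>)) \<longlonglongrightarrow> 0"
  unfolding mean_cycle_def
proof (rule weak_law_of_large_numbers)
  show "indep_vars (\<lambda>_. borel) (\<lambda>j \<omega>. real (cycle_length S j \<omega>)) {1..}"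
    by (rule indep_vars_compose2[OF indep_vars_subset[OF indep_cycle_length]]) auto
  fix j :: nat assume "1 \<le> j"
  have "distr M borel (\<lambda>\<omega>. real (cycle_length S j \<omega>)) = distr (distr M (count_space UNIV) (cycle_length S j)) borel real" for j
    by (subst distr_distr) (auto simp: comp_def)
  then show "distr M borel (\<lambda>\<omega>. real (cycle_length S j \<omega>)) = distr M borel (\<lambda>\<omega>. real (cycle_length S 1 \<omega>))"
    by (simp only: distr_cycle_length[OF \<open>1 \<le> j\<close>])
qed (use integrable_cycle_length \<open>0 < \<epsilon>\<close> in auto)

abbreviation (input) expected_cycles :: "nat \<Rightarrow> real" where
  "expected_cycles n \<equiv> real n / mean_cycle M S"

lemma expected_cycles_at_top: "filterlim expected_cycles at_top sequentially"
proof -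
  have "filterlim (\<lambda>n. 1 / mean_cycle M S * real n) at_top sequentially"
    using mean_cycle_ge_1
    by (intro filterlim_tendsto_pos_mult_at_top[OF tendsto_const _ filterlim_real_sequentially]) auto
  then show ?thesis by simp
qed

lemma filterlim_ceiling_expected_cycles:
  fixes c :: real
  assumes "0 < c"
  shows "filterlim (\<lambda>n. nat \<lceil>c * expected_cycles n\<rceil>) sequentially sequentially"
  unfolding filterlim_sequentially_iff_filterlim_real
proof (rule filterlim_at_top_mono)
  show "filterlim (\<lambda>n. c * expected_cycles n) at_top sequentially"
    by (rule filterlim_tendsto_pos_mult_at_top[OF tendsto_const assms expected_cycles_at_top])
qed (simp only: real_nat_ceiling_ge eventually_True)

lemma real_regeneration_time:
  "\<omega> \<in> space M \<Longrightarrow> real (S m \<omega>) = real (S 0 \<omega>) + (\<Sum>j=1..m. real (cycle_length S j \<omega>))"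
  using regeneration_time_eq[of S \<omega> m] S_less by simp

text \<open>The expected duration of the cycles \<open>1, \<dots>, l\<close> is at most \<open>(1 - \<epsilon>) *
  n\<close>. If they end after \<open>n\<close> nevertheless, then either the initial cycle is longer than
  \<open>\<epsilon> / 2 * n\<close>, or the remaining cycles exceed their expectation by at least that much,
  which is of the order of \<open>l\<close>.\<close>

lemma prob_regeneration_late_tendsto_0:
  assumes "0 < \<epsilon>" "\<epsilon> < 1"
  shows "(\<lambda>n. \<P>(\<omega> in M. n + 1 < S (nat \<lfloor>(1 - \<epsilon>) * expected_cycles n\<rfloor>) \<omega>)) \<longlonglongrightarrow> 0"
proof -
  let ?\<mu> = "mean_cycle M S" and ?l = "\<lambda>n. nat \<lfloor>(1 - \<epsilon>) * expected_cycles n\<rfloor>"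
  define p where "p m = \<P>(\<omega> in M. (\<epsilon> / 2 * ?\<mu>) * m \<le> \<bar>(\<Sum>j=1..m. real (cycle_length S j \<omega>)) - m * ?\<mu>\<bar>)" for m
  have "filterlim ?l at_top sequentially"
    by (intro filterlim_compose[OF filterlim_nat_sequentially] filterlim_compose[OF filterlim_floor_sequentially]
        filterlim_tendsto_pos_mult_at_top[OF tendsto_const _ expected_cycles_at_top]) (use assms in auto)
  moreover have "p \<longlonglongrightarrow> 0"
    unfolding p_def by (rule cycle_lengths_weak_law) (use mean_cycle_ge_1 assms in auto)
  ultimately have "(\<lambda>n. p (?l n)) \<longlonglongrightarrow> 0"
    by (rule filterlim_compose[rotated])
  moreover have "(\<lambda>n. \<P>(\<omega> in M. \<epsilon> / 2 * real n < real (S 0 \<omega>))) \<longlonglongrightarrow> 0"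
    using assms by (intro prob_real_nat_gt_tendsto_0) auto
  ultimately have lim: "(\<lambda>n. \<P>(\<omega> in M. \<epsilon> / 2 * real n < real (S 0 \<omega>)) + p (?l n)) \<longlonglongrightarrow> 0"
    by (auto dest: tendsto_add)
  have "\<P>(\<omega> in M. n + 1 < S (?l n) \<omega>) \<le> \<P>(\<omega> in M. \<epsilon> / 2 * real n < real (S 0 \<omega>)) + p (?l n)" for n
  proof -
    have "real (?l n) \<le> (1 - \<epsilon>) * expected_cycles n"
      using assms mean_cycle_ge_1 by (intro of_nat_floor) auto
    then have l: "real (?l n) * ?\<mu> \<le> (1 - \<epsilon>) * n"
      using mean_cycle_ge_1 by (simp add: field_simps)
    have l': "\<epsilon> / 2 * ?\<mu> * real (?l n) \<le> \<epsilon> / 2 * n"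
    proof -
      have "(1 - \<epsilon>) * n \<le> 1 * real n" using assms by (intro mult_right_mono) auto
      then have "\<epsilon> / 2 * (real (?l n) * ?\<mu>) \<le> \<epsilon> / 2 * n"
        using l assms by (intro mult_left_mono) auto
      then show ?thesis by (simp add: mult_ac)
    qed
    have "(\<epsilon> / 2 * ?\<mu>) * ?l n \<le> \<bar>(\<Sum>j=1..?l n. real (cycle_length S j \<omega>)) - ?l n * ?\<mu>\<bar>
      \<or> \<epsilon> / 2 * real n < real (S 0 \<omega>)"
      if "\<omega> \<in> space M" "n + 1 < S (?l n) \<omega>" for \<omega>
    proof (rule disjCI)
      assume "\<not> \<epsilon> / 2 * real n < real (S 0 \<omega>)"
      moreover have "real n < real (S (?l n) \<omega>)" using that(2) by simp
      moreover have "(1 - \<epsilon>) * n = n - \<epsilon> * n" by (simp add: algebra_simps)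
      ultimately show "(\<epsilon> / 2 * ?\<mu>) * ?l n \<le> \<bar>(\<Sum>j=1..?l n. real (cycle_length S j \<omega>)) - ?l n * ?\<mu>\<bar>"
        using l l' real_regeneration_time[OF that(1), of "?l n"] by linarith
    qed
    then have "\<P>(\<omega> in M. n + 1 < S (?l n) \<omega>) \<le> prob ({\<omega>\<in>space M. \<epsilon> / 2 * real n < real (S 0 \<omega>)} \<union>
       {\<omega>\<in>space M. (\<epsilon> / 2 * ?\<mu>) * ?l n \<le> \<bar>(\<Sum>j=1..?l n. real (cycle_length S j \<omega>)) - ?l n * ?\<mu>\<bar>})"
      by (intro finite_measure_mono) (blast, measurable)
    also have "\<dots> \<le> \<P>(\<omega> in M. \<epsilon> / 2 * real n < real (S 0 \<omega>)) + p (?l n)"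
      unfolding p_def by (intro measure_Un_le) measurable
    finally show ?thesis .
  qed
  then show ?thesis
    by (intro tendsto_sandwich[OF _ _ tendsto_const lim]) auto
qed

text \<open>Here the initial cycle can only help, and the weak law alone decides.\<close>

lemma prob_regeneration_early_tendsto_0:
  assumes "0 < \<epsilon>" "\<epsilon> < 1"
  shows "(\<lambda>n. \<P>(\<omega> in M. S (nat \<lceil>(1 + \<epsilon>) * expected_cycles n\<rceil>) \<omega> \<le> n)) \<longlonglongrightarrow> 0"
proof -
  let ?\<mu> = "mean_cycle M S" and ?h = "\<lambda>n. nat \<lceil>(1 + \<epsilon>) * expected_cycles n\<rceil>"
  define p where "p m = \<P>(\<omega> in M. (\<epsilon> / 2 * ?\<mu>) * m \<le> \<bar>(\<Sum>j=1..m. real (cycle_length S j \<omega>)) - m * ?\<mu>\<bar>)" for m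
  have "filterlim ?h sequentially sequentially"
    by (rule filterlim_ceiling_expected_cycles) (use assms in auto)
  moreover have "p \<longlonglongrightarrow> 0"
    unfolding p_def by (rule cycle_lengths_weak_law) (use mean_cycle_ge_1 assms in auto)
  ultimately have lim: "(\<lambda>n. p (?h n)) \<longlonglongrightarrow> 0"
    by (rule filterlim_compose[rotated])
  have "\<P>(\<omega> in M. S (?h n) \<omega> \<le> n) \<le> p (?h n)" for n
  proof -
    have "(1 + \<epsilon>) * expected_cycles n \<le> real (?h n)" by (rule real_nat_ceiling_ge)
    then have "(1 + \<epsilon>) * n \<le> real (?h n) * ?\<mu>"
      using mean_cycle_ge_1 by (simp add: field_simps)
    \<comment> \<open>The factor \<open>1 - \<epsilon> / 2\<close> leaves room for a deviation of \<open>\<epsilon> / 2 * \<mu> *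
      h\<close> because \<open>(1 - \<epsilon> / 2) * (1 + \<epsilon>) \<ge> 1\<close>.\<close>
    then have "(1 - \<epsilon> / 2) * ((1 + \<epsilon>) * n) \<le> (1 - \<epsilon> / 2) * (real (?h n) * ?\<mu>)"
      using assms by (intro mult_left_mono) auto
    moreover have "1 * real n \<le> (1 - \<epsilon> / 2) * (1 + \<epsilon>) * n"
    proof (intro mult_right_mono)
      have "0 \<le> \<epsilon> * (1 - \<epsilon>) / 2" using assms by auto
      also have "\<dots> = (1 - \<epsilon> / 2) * (1 + \<epsilon>) - 1" by (simp add: field_simps)
      finally show "1 \<le> (1 - \<epsilon> / 2) * (1 + \<epsilon>)" by simp
    qed auto
    ultimately have h: "\<epsilon> / 2 * ?\<mu> * real (?h n) \<le> real (?h n) * ?\<mu> - n"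
      by (simp add: algebra_simps)
    have "(\<epsilon> / 2 * ?\<mu>) * ?h n \<le> \<bar>(\<Sum>j=1..?h n. real (cycle_length S j \<omega>)) - ?h n * ?\<mu>\<bar>"
      if "\<omega> \<in> space M" "S (?h n) \<omega> \<le> n" for \<omega>
    proof -
      have "real (S (?h n) \<omega>) \<le> n" "0 \<le> real (S 0 \<omega>)" using that(2) by auto
      then show ?thesis using h real_regeneration_time[OF that(1), of "?h n"] by linarith
    qed
    then show ?thesis
      unfolding p_def by (intro finite_measure_mono) (blast, measurable)
  qed
  then show ?thesis
    by (intro tendsto_sandwich[OF _ _ tendsto_const lim]) auto
qed

lemma order_max_uniform_partial_sum:
  assumes q: "1 \<le> q" "q \<le> r" and "0 < \<delta>"
  shows "\<forall>\<^sub>F n in sequentially. \<forall>x. \<bar>\<P>(\<omega> in M. order_max X q n \<omega> \<le> ereal x)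
    - \<P>(\<omega> in M. partial_sum (exceed X S r x) (nat \<lfloor>expected_cycles n\<rfloor>) \<omega> < q)\<bar> \<le> \<delta>"
proof -
  \<comment> \<open>With this choice \<open>nat_ceiling_floor_gap_le\<close> bounds the probability of a crossing by
    \<open>\<delta> / 4\<close>.\<close>
  define \<epsilon> where "\<epsilon> = min (1 / 2) (\<delta> / (64 * (real q)\<^sup>2))"
  have \<epsilon>: "0 < \<epsilon>" "\<epsilon> \<le> 1 / 2" "\<epsilon> \<le> \<delta> / (64 * (real q)\<^sup>2)" using q \<open>0 < \<delta>\<close> by (auto simp: \<epsilon>_def)
  then have \<epsilon>q: "16 * (real q)\<^sup>2 * \<epsilon> \<le> \<delta> / 4" using q by (simp add: field_simps)
  let ?l = "\<lambda>n. nat \<lfloor>(1 - \<epsilon>) * expected_cycles n\<rfloor>" and ?h = "\<lambda>n. nat \<lceil>(1 + \<epsilon>) * expected_cycles n\<rceil>"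
  define z where "z L = \<P>(\<omega> in M. (MAX k\<in>{1..L}. cycle_max X S 1 k \<omega>) < cycle_max X S 1 0 \<omega>)" for L
  have h_lim: "filterlim (\<lambda>n. ?h n div q) at_top sequentially"
  proof (rule filterlim_compose[where g = "\<lambda>m. m div q"])
    show "filterlim (\<lambda>m. m div q) at_top sequentially"
      using q by (intro filterlim_at_top_div_const_nat) auto
    show "filterlim ?h sequentially sequentially"
    by (rule filterlim_ceiling_expected_cycles) (use \<epsilon> in auto)
  qed
  have "(\<lambda>n. real q * z (?h n div q)) \<longlonglongrightarrow> real q * 0"
    unfolding z_def
    by (intro tendsto_mult tendsto_const filterlim_compose[OF first_cycle_negligible h_lim])
  then have "\<forall>\<^sub>F n in sequentially. real q * z (?h n div q) < \<delta> / 4"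
    using \<open>0 < \<delta>\<close> by (intro order_tendstoD(2)) auto
  moreover have "\<forall>\<^sub>F n in sequentially. \<P>(\<omega> in M. n + 1 < S (?l n) \<omega>) < \<delta> / 4"
    using \<open>0 < \<delta>\<close> \<epsilon> by (intro order_tendstoD(2)[OF prob_regeneration_late_tendsto_0]) auto
  moreover have "\<forall>\<^sub>F n in sequentially. \<P>(\<omega> in M. S (?h n) \<omega> \<le> n) < \<delta> / 4"
    using \<open>0 < \<delta>\<close> \<epsilon> by (intro order_tendstoD(2)[OF prob_regeneration_early_tendsto_0]) auto
  moreover have "\<forall>\<^sub>F n in sequentially. max 4 (1 / \<epsilon>) \<le> expected_cycles n"
    using expected_cycles_at_top unfolding filterlim_at_top by blast
  moreover have "\<forall>\<^sub>F n in sequentially. 1 \<le> ?h n div q"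
    using h_lim unfolding filterlim_at_top by blast
  ultimately show ?thesis
  proof eventually_elim
    case (elim n)
    let ?t = "expected_cycles n"
    have t: "4 \<le> ?t" "1 \<le> \<epsilon> * ?t" using elim(4) \<epsilon> by (auto simp: field_simps)
    have "(1 - \<epsilon>) * ?t \<le> 1 * ?t" "1 * ?t \<le> (1 + \<epsilon>) * ?t"
      by (rule mult_right_mono; use \<epsilon> t in linarith)+
    then have lh: "?l n \<le> nat \<lfloor>?t\<rfloor>" "nat \<lfloor>?t\<rfloor> \<le> ?h n"
      using floor_mono[of "(1 - \<epsilon>) * ?t" ?t] ceiling_mono[of ?t "(1 + \<epsilon>) * ?t"] floor_le_ceiling[of ?t]
      by (auto intro!: nat_mono simp del: floor_le_ceiling)
    show ?case
    proof
      fix x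
      have "\<P>(\<omega> in M. partial_sum (exceed X S r x) (?l n) \<omega> < q \<and> q \<le> partial_sum (exceed X S r x) (?h n) \<omega>) \<le> \<delta> / 4"
        using count.prob_partial_sum_crosses_le[of "?l n" "?h n" x q] lh \<epsilon>q
          nat_ceiling_floor_gap_le[OF \<epsilon>(1,2) t q(1)] by linarith
      moreover have "\<P>(\<omega> in M. partial_sum (exceed X S r x) (?h n) \<omega> < q \<and> exceed X S r x 0 \<omega> \<noteq> 0) \<le> real q * z (?h n div q)"
        unfolding z_def using elim(5) by (intro prob_first_cycle_exceeds_le) auto
      ultimately show "\<bar>\<P>(\<omega> in M. order_max X q n \<omega> \<le> ereal x)
        - \<P>(\<omega> in M. partial_sum (exceed X S r x) (nat \<lfloor>?t\<rfloor>) \<omega> < q)\<bar> \<le> \<delta>"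
        using prob_order_max_approx[OF q lh, of n x] elim(1-3) by linarith
    qed
  qed
qed

end

section \<open>The limit distribution\<close>

lemma SUP_ereal_tendsto_0I:
  fixes f :: "nat \<Rightarrow> real \<Rightarrow> real"
  assumes "\<And>\<epsilon>. 0 < \<epsilon> \<Longrightarrow> \<forall>\<^sub>F n in sequentially. \<forall>x. \<bar>f n x\<bar> \<le> \<epsilon>"
  shows "(\<lambda>n. SUP x. ereal \<bar>f n x\<bar>) \<longlonglongrightarrow> 0"
proof (rule order_tendstoI)
  fix a :: ereal assume "a < 0"
  have "0 \<le> (SUP x. ereal \<bar>f n x\<bar>)" for n
    by (rule SUP_upper2[of 0]) auto
  then show "\<forall>\<^sub>F n in sequentially. a < (SUP x. ereal \<bar>f n x\<bar>)"
    using less_le_trans[OF \<open>a < 0\<close>] by (intro always_eventually) blast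
next
  fix a :: ereal assume "0 < a"
  then obtain e where e: "0 < ereal e" "ereal e < a" using ereal_dense2 by blast
  show "\<forall>\<^sub>F n in sequentially. (SUP x. ereal \<bar>f n x\<bar>) < a"
    using assms[of e] e by (force elim!: eventually_mono intro: le_less_trans[OF SUP_least])
qed

context max_regenerative_process
begin

text \<open>A binomial term with \<open>k \<ge> 1\<close> is at most \<open>1\<close>, vanishes where \<open>cycle_cdf x =
  1\<close>, and tends to \<open>0\<close> uniformly below any level \<open>x0\<close> with \<open>cycle_cdf x0
  < 1\<close>. So the weights need to converge only between a suitable \<open>x0\<close> and the right endpoint.\<close>

lemma cluster_weights_uniform:
  assumes q: "q \<in> {2..r}" and k: "1 \<le> k" and "0 < \<delta>"
    and lim: "\<And>i. i \<in> {1..r-1} \<Longrightarrow>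
      (cluster_prob M X S i \<longlongrightarrow> \<beta> i) (real_at_left (right_endpoint (cycle_df M X S)))"
  shows "\<forall>\<^sub>F m in sequentially. \<forall>x. binom_term m k (cycle_cdf x) *
    \<bar>gamma_coeff (\<lambda>i. cluster_prob M X S i x) q k - gamma_coeff \<beta> q k\<bar> \<le> \<delta>"
proof (cases "\<exists>x. cycle_cdf x < 1")
  case False
  then have "cycle_cdf x = 1" for x using cycle_cdf_bounds(2)[of x] by (metis less_le)
  then show ?thesis using k \<open>0 < \<delta>\<close> by (simp add: binom_term_def power_0_left)
next
  case True
  let ?g = "\<lambda>x. gamma_coeff (\<lambda>i. cluster_prob M X S i x) q k"
  define K where "K = gamma_coeff (\<lambda>_. 1) q k + \<bar>gamma_coeff \<beta> q k\<bar>"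
  have K: "\<bar>?g x - gamma_coeff \<beta> q k\<bar> \<le> K" for x
  proof -
    have "\<bar>?g x\<bar> \<le> gamma_coeff (\<lambda>_. 1) q k"
      using cluster_prob_bounds by (intro abs_gamma_coeff_le) auto
    then show ?thesis unfolding K_def by linarith
  qed
  have "(?g \<longlongrightarrow> gamma_coeff \<beta> q k) (real_at_left (right_endpoint (cycle_df M X S)))"
    using q by (intro tendsto_gamma_coeff lim) auto
  then have "\<forall>\<^sub>F x in real_at_left (right_endpoint (cycle_df M X S)). dist (?g x) (gamma_coeff \<beta> q k) < \<delta>"
    using \<open>0 < \<delta>\<close> by (rule tendstoD)
  from eventually_real_at_left_right_endpointD[OF this True]
  obtain x0 where x0: "cycle_cdf x0 < 1"
    "\<And>x. x0 < x \<Longrightarrow> cycle_cdf x < 1 \<Longrightarrow> \<bar>?g x - gamma_coeff \<beta> q k\<bar> < \<delta>"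
    by (auto simp: dist_real_def)
  have "(\<lambda>m. real m ^ k * cycle_cdf x0 ^ (m - k) * K) \<longlonglongrightarrow> 0 * K"
    using x0(1) cycle_cdf_bounds by (intro tendsto_mult power_times_geometric_tendsto_0 tendsto_const) auto
  then have "\<forall>\<^sub>F m in sequentially. real m ^ k * cycle_cdf x0 ^ (m - k) * K < \<delta>"
    by (rule order_tendstoD(2)) (use \<open>0 < \<delta>\<close> in simp)
  then show ?thesis
  proof eventually_elim
    case (elim m)
    show ?case
    proof
      fix x
      let ?F = "cycle_cdf x"
      consider "x \<le> x0" | "x0 < x" "?F < 1" | "?F = 1" using cycle_cdf_bounds(2)[of x] by linarith
      then show "binom_term m k ?F * \<bar>?g x - gamma_coeff \<beta> q k\<bar> \<le> \<delta>"
      proof cases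
        case 1
        have "binom_term m k ?F \<le> real m ^ k * ?F ^ (m - k)"
          using cycle_cdf_bounds by (intro binom_term_le)
        also have "\<dots> \<le> real m ^ k * cycle_cdf x0 ^ (m - k)"
          using cycle_cdf_bounds cycle_cdf_mono[OF 1] by (intro mult_left_mono power_mono) auto
        finally have "binom_term m k ?F * \<bar>?g x - gamma_coeff \<beta> q k\<bar> \<le> real m ^ k * cycle_cdf x0 ^ (m - k) * K"
          using K[of x] cycle_cdf_bounds by (intro mult_mono) auto
        then show ?thesis using elim by linarith
      next
        case 2
        have "binom_term m k ?F * \<bar>?g x - gamma_coeff \<beta> q k\<bar> \<le> 1 * \<delta>"
          using binom_term_le_1[of ?F m k] cycle_cdf_bounds x0(2)[OF 2] \<open>0 < \<delta>\<close>
          by (intro mult_mono) auto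
        then show ?thesis by simp
      next
        case 3
        then show ?thesis using k \<open>0 < \<delta>\<close> by (simp add: binom_term_def power_0_left)
      qed
    qed
  qed
qed

lemma binom_gamma_uniform:
  assumes q: "q \<in> {2..r}" and "0 < \<delta>"
    and lim: "\<And>i. i \<in> {1..r-1} \<Longrightarrow>
      (cluster_prob M X S i \<longlongrightarrow> \<beta> i) (real_at_left (right_endpoint (cycle_df M X S)))"
  shows "\<forall>\<^sub>F n in sequentially. \<forall>x.
    \<bar>binom_term (nat \<lfloor>expected_cycles n\<rfloor>) k (cycle_cdf x) * gamma_coeff (\<lambda>i. cluster_prob M X S i x) q k
     - poisson_term (expected_cycles n) k (cycle_cdf x) * gamma_coeff \<beta> q k\<bar> \<le> \<delta>"
proof -
  let ?c = "gamma_coeff \<beta> q k" and ?g = "\<lambda>x. gamma_coeff (\<lambda>i. cluster_prob M X S i x) q k"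
  let ?b = "\<lambda>n x. binom_term (nat \<lfloor>expected_cycles n\<rfloor>) k (cycle_cdf x)"
  let ?p = "\<lambda>n x. poisson_term (expected_cycles n) k (cycle_cdf x)"
  \<comment> \<open>The summand \<open>1\<close> only avoids a division by \<open>0\<close>.\<close>
  define e where "e = \<delta> / 2 / (\<bar>?c\<bar> + 1)"
  have "0 < e" using \<open>0 < \<delta>\<close> by (simp add: e_def add_nonneg_pos)
  have "\<forall>\<^sub>F n in sequentially. \<forall>a\<in>{0..1}. \<bar>binom_term (nat \<lfloor>expected_cycles n\<rfloor>) k a - poisson_term (expected_cycles n) k a\<bar> \<le> e"
    using eventually_compose_filterlim[OF binom_term_tendsto_poisson_term[OF \<open>0 < e\<close>] expected_cycles_at_top] .
  moreover have "\<forall>\<^sub>F n in sequentially. \<forall>x. ?b n x * \<bar>?g x - ?c\<bar> \<le> \<delta> / 2"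
  proof (cases "k = 0")
    case True
    then show ?thesis using \<open>0 < \<delta>\<close> by (simp add: gamma_coeff_0)
  next
    case False
    have "filterlim (\<lambda>n. nat \<lfloor>expected_cycles n\<rfloor>) sequentially sequentially"
      by (intro filterlim_compose[OF filterlim_nat_sequentially] filterlim_compose[OF filterlim_floor_sequentially]
        expected_cycles_at_top)
    with cluster_weights_uniform[OF q _ _ lim, of k "\<delta> / 2"] False \<open>0 < \<delta>\<close> show ?thesis
      by (intro eventually_compose_filterlim[where f = "\<lambda>n. nat \<lfloor>expected_cycles n\<rfloor>"]) auto
  qed
  ultimately show ?thesis
  proof eventually_elim
    case (elim n)
    show ?case
    proof
      fix x
      have "\<bar>?b n x - ?p n x\<bar> * \<bar>?c\<bar> \<le> e * (\<bar>?c\<bar> + 1)"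
        using elim(1) cycle_cdf_bounds[of x] \<open>0 < e\<close> by (intro mult_mono) auto
      also have "\<dots> = \<delta> / 2"
        unfolding e_def using nonzero_eq_divide_eq[of "\<bar>?c\<bar> + 1" "\<delta> / 2 / (\<bar>?c\<bar> + 1)" "\<delta> / 2"]
        by linarith
      finally have 1: "\<bar>(?b n x - ?p n x) * ?c\<bar> \<le> \<delta> / 2" by (simp add: abs_mult)
      have 2: "\<bar>?b n x * (?g x - ?c)\<bar> \<le> \<delta> / 2"
        using elim(2) binom_term_nonneg[OF cycle_cdf_bounds] by (simp add: abs_mult)
      \<comment> \<open>The change of the terms is paired with the limit weights, which do not depend on \<open>x\<close>.\<close>
      have "?b n x * ?g x - ?p n x * ?c = (?b n x - ?p n x) * ?c + ?b n x * (?g x - ?c)"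
        by (simp add: algebra_simps)
      then show "\<bar>?b n x * ?g x - ?p n x * ?c\<bar> \<le> \<delta>" using 1 2 by linarith
    qed
  qed
qed

text \<open>At \<open>cycle_cdf x = 0\<close> both sides are \<open>0\<close>, also for \<open>k = 0\<close>, since
  \<open>n \<ge> 1\<close>.\<close>

lemma cycle_df_power_eq_poisson_term:
  assumes "1 \<le> n"
  shows "cycle_df M X S x ^ n * ((- ln (cycle_df M X S x ^ n)) ^ k / fact k)
    = poisson_term (expected_cycles n) k (cycle_cdf x)"
proof (cases "cycle_cdf x = 0")
  case True
  then show ?thesis using assms by (simp add: cycle_df_eq poisson_term_def)
next
  case False
  then have "0 < cycle_cdf x" using cycle_cdf_bounds[of x] by simp
  then have "cycle_df M X S x ^ n = cycle_cdf x powr expected_cycles n"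
    by (simp add: cycle_df_eq powr_powr flip: powr_realpow)
  then show ?thesis using \<open>0 < cycle_cdf x\<close> by (simp add: poisson_term_def ln_powr)
qed

end

theorem corollary3:
  fixes M :: "'a measure"
    and X :: "nat \<Rightarrow> 'a \<Rightarrow> real"
    and S :: "nat \<Rightarrow> 'a \<Rightarrow> nat"
    and r :: nat
    and \<beta> :: "nat \<Rightarrow> real"
  assumes "prob_space M"
    and "1 \<le> r"
    and "\<And>n. X n \<in> borel_measurable M"
    and "max_regenerative M r X S"
    and "integrable M (\<lambda>\<omega>. real (cycle_length S 1 \<omega>))"
    and "(\<lambda>n. \<P>(\<omega> in M. (MAX k\<in>{1..n}. cycle_max X S 1 k \<omega>) < cycle_max X S 1 0 \<omega>))
           \<longlonglongrightarrow> 0"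
    and "\<And>i. i \<in> {1..r-1} \<Longrightarrow> \<beta> i \<in> {0..1}"
    and "\<And>i. i \<in> {1..r-1} \<Longrightarrow>
           (cluster_prob M X S i \<longlongrightarrow> \<beta> i)
             (real_at_left (right_endpoint (cycle_df M X S)))"
  shows "\<forall>q\<in>{2..r}.
    (\<lambda>n. SUP x::real. ereal
       \<bar>\<P>(\<omega> in M. order_max X q n \<omega> \<le> ereal x)
         - cycle_df M X S x ^ n
           * (\<Sum>k=0..q-1. (- ln (cycle_df M X S x ^ n)) ^ k / fact k * gamma_coeff \<beta> q k)\<bar>)
      \<longlonglongrightarrow> 0"
proof (intro ballI SUP_ereal_tendsto_0I)
  interpret prob_space M by fact
  interpret max_regenerative_process M r X S by unfold_locales (fact assms)+
  fix q and \<epsilon> :: real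
  assume q: "q \<in> {2..r}" and "0 < \<epsilon>"
  let ?b = "\<lambda>n k x. binom_term (nat \<lfloor>expected_cycles n\<rfloor>) k (cycle_cdf x) * gamma_coeff (\<lambda>i. cluster_prob M X S i x) q k"
  let ?p = "\<lambda>n k x. poisson_term (expected_cycles n) k (cycle_cdf x) * gamma_coeff \<beta> q k"
  define \<delta> where "\<delta> = \<epsilon> / (2 * real q)"
  have "0 < \<delta>" using q \<open>0 < \<epsilon>\<close> by (simp add: \<delta>_def)
  have "\<forall>\<^sub>F n in sequentially. \<forall>k\<in>{0..q-1}. \<forall>x. \<bar>?b n k x - ?p n k x\<bar> \<le> \<delta>"
    by (intro eventually_ball_finite ballI binom_gamma_uniform q \<open>0 < \<delta>\<close> assms) auto
  moreover have "\<forall>\<^sub>F n in sequentially. \<forall>x. \<bar>\<P>(\<omega> in M. order_max X q n \<omega> \<le> ereal x)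
      - \<P>(\<omega> in M. partial_sum (exceed X S r x) (nat \<lfloor>expected_cycles n\<rfloor>) \<omega> < q)\<bar> \<le> \<epsilon> / 2"
    using q \<open>0 < \<epsilon>\<close> by (intro order_max_uniform_partial_sum) auto
  moreover have "\<forall>\<^sub>F n::nat in sequentially. 1 \<le> n"
    by (rule eventually_ge_at_top)
  ultimately show "\<forall>\<^sub>F n in sequentially. \<forall>x. \<bar>\<P>(\<omega> in M. order_max X q n \<omega> \<le> ereal x)
         - cycle_df M X S x ^ n
           * (\<Sum>k=0..q-1. (- ln (cycle_df M X S x ^ n)) ^ k / fact k * gamma_coeff \<beta> q k)\<bar> \<le> \<epsilon>"
  proof eventually_elim
    case (elim n)
    show ?case
    proof
      fix x
      have "cycle_df M X S x ^ n * (\<Sum>k=0..q-1. (- ln (cycle_df M X S x ^ n)) ^ k / fact k * gamma_coeff \<beta> q k)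
          = (\<Sum>k=0..q-1. ?p n k x)"
        unfolding sum_distrib_left cycle_df_power_eq_poisson_term[OF elim(3), symmetric]
        by (simp only: mult.assoc)
      moreover have "\<bar>(\<Sum>k=0..q-1. ?b n k x) - (\<Sum>k=0..q-1. ?p n k x)\<bar> \<le> \<epsilon> / 2"
      proof -
        have "\<bar>(\<Sum>k=0..q-1. ?b n k x) - (\<Sum>k=0..q-1. ?p n k x)\<bar> \<le> (\<Sum>k=0..q-1. \<bar>?b n k x - ?p n k x\<bar>)"
          unfolding sum_subtractf[symmetric] by (rule sum_abs)
        also have "\<dots> \<le> (\<Sum>k=0..q-1. \<delta>)"
          using elim(1) by (intro sum_mono) auto
        also have "\<dots> = \<epsilon> / 2" using q by (simp add: \<delta>_def)
        finally show ?thesis .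
      qed
      ultimately show "\<bar>\<P>(\<omega> in M. order_max X q n \<omega> \<le> ereal x)
         - cycle_df M X S x ^ n
           * (\<Sum>k=0..q-1. (- ln (cycle_df M X S x ^ n)) ^ k / fact k * gamma_coeff \<beta> q k)\<bar> \<le> \<epsilon>"
        using spec[OF elim(2), of x] unfolding prob_partial_sum_less[OF q] by linarith
    qed
  qed
qed

end
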